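(* Let $(\mathcal{X},\rho,\mu)$ be a space of homogeneous type satisfying the weak reverse doubling (WRD) condition. Let $\varphi\in\mathcal{G}^{\rm dec}_1$ satisfy the nearness condition and let $\Phi$ be an Orlicz function with lower type $r_\Phi^-$ and upper type $r_\Phi^+$, where $1<r_\Phi^-\le r_\Phi^+<\infty$. Then the Hardy--Littlewood maximal operator $\mathcal{M}$ is bounded on the generalized Orlicz--Morrey space $L^{(\Phi,\varphi)}(\mathcal{X})$.
   Context: A quasi-metric on a nonempty set $\mathcal{X}$ is $\rho:\mathcal{X}\times\mathcal{X}\to[0,\infty)$ with $\rho(x,y)=0$ iff $x=y$, $\rho(x,y)=\rho(y,x)$, and $\rho(x,z)\le K_0[\rho(x,y)+\rho(y,z)]$ for some constant $K_0\in[1,\infty)$. Balls: $B(x,r):=\{y:\rho(x,y)<r\}$. $(\mathcal{X},\rho,\mu)$ is a space of homogeneous type if $\rho$ is a quasi-metric, $\mu$ is a nonnegative measure on a $\sigma$-algebra containing all balls, and there is $L_{(\mu)}\in[1,\infty)$ with $0<\mu(B(x,2r))\le L_{(\mu)}\mu(B(x,r))<\infty$ for all $x,r$. WRD condition: there exist $x_0\in\mathcal{X}$ and $\lambda,C_{(\mu)}\in(1,\infty)$ with $\liminf_{r\to\infty}\frac{\mu(B(x_0,\lambda r))}{\mu(B(x_0,r))}\ge C_{(\mu)}$. $\mathcal{M}f(x):=\sup_{B\ni x}\frac1{\mu(B)}\int_B|f|\,d\mu$, supremum over all balls containing $x$. For $\varphi:\mathcal{X}\times(0,\infty)\to(0,\infty)$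 and $B=B(x,r)$, write $\varphi(B):=\varphi(x,r)$. Nearness condition: there is $C>0$ with $\frac1C\le\frac{\varphi(x,r)}{\varphi(y,r)}\le C$ whenever $\rho(x,y)\le r$. $\mathcal{G}^{\rm dec}_1$: functions $\varphi:\mathcal{X}\times(0,\infty)\to(0,\infty)$ for which there is $C>0$ with $\mu(B(x,r))\varphi(x,r)\le C\mu(B(x,s))\varphi(x,s)$ and $\varphi(x,s)\le C\varphi(x,r)$ for all $x\in\mathcal{X}$, $0<r<s<\infty$. An Orlicz function is a non-decreasing $\Phi:[0,\infty)\to[0,\infty)$ with $\Phi(0)=0$, $\Phi(t)>0$ for $t>0$, $\lim_{t\to\infty}\Phi(t)=\infty$. It is of lower (resp. upper) type $r$ if there is $C_{(r)}\in[1,\infty)$ with $\Phi(st)\le C_{(r)}s^r\Phi(t)$ for all $t\in(0,\infty)$ and $s\in(0,1)$ (resp. $s\in(1,\infty)$). Standing assumption: $\Phi$ is strictly increasing, and convex when $1\le r_\Phi^-\le r_\Phi^+<\infty$. $\|f\|_{L^\Phi(\mathcal{X})}:=\inf\{\lambda>0:\int_{\mathcal{X}}\Phi(|f|/\lambda)\,d\mu\le1\}$; $L^\Phi_{\mathrm{loc}}(\mathcal{X})$: measurable $f$ such that each $x$ has some $r_x>0$ with $\|f\mathbf{1}_{B(x,r_x)}\|_{L^\Phi(\mathcal{X})}<\infty$. $L^{(\Phi,\varphi)}(\mathcal{X})$: all $f\in L^\Phi_{\mathrm{loc}}(\mathcal{X})$ with $\|f\|_{L^{(\Phi,\varphi)}(\mathcal{X})}:=\sup_B\|f\|_{\Phi,\varphi,B}<\infty$,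 supremum over all balls, where $\|f\|_{\Phi,\varphi,B}:=\inf\{\lambda\in(0,\infty):\frac1{\mu(B)}\int_B\Phi(\frac{|f|}{\lambda})\,d\mu\le\varphi(B)\}$. Bounded means there is a constant $C$ with $\|\mathcal{M}f\|\le C\|f\|$ for all $f$ in the space. *)

theory Defs
  imports "HOL-Analysis.Analysis"
begin

section \<open>Spaces of homogeneous type\<close>

definition quasi_metric_on :: "'a set \<Rightarrow> ('a \<Rightarrow> 'a \<Rightarrow> real) \<Rightarrow> bool" where
  "quasi_metric_on X \<rho> \<longleftrightarrow>
     (\<forall>x\<in>X. \<forall>y\<in>X. 0 \<le> \<rho> x y) \<and>
     (\<forall>x\<in>X. \<forall>y\<in>X. \<rho> x y = 0 \<longleftrightarrow> x = y) \<and>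
     (\<forall>x\<in>X. \<forall>y\<in>X. \<rho> x y = \<rho> y x) \<and>
     (\<exists>K\<ge>1. \<forall>x\<in>X. \<forall>y\<in>X. \<forall>z\<in>X. \<rho> x z \<le> K * (\<rho> x y + \<rho> y z))"

definition qball :: "'a set \<Rightarrow> ('a \<Rightarrow> 'a \<Rightarrow> real) \<Rightarrow> 'a \<Rightarrow> real \<Rightarrow> 'a set" where
  "qball X \<rho> x r = {y \<in> X. \<rho> x y < r}"

text \<open>The underlying set of the space is \<^term>\<open>space M\<close>; the \<open>\<sigma>\<close>-algebra \<^term>\<open>sets M\<close> may be
  any one that contains the balls.\<close>

definition homogeneous_type :: "'a measure \<Rightarrow> ('a \<Rightarrow> 'a \<Rightarrow> real) \<Rightarrow> bool" where
  "homogeneous_type M \<rho> \<longleftrightarrow>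
     space M \<noteq> {} \<and> quasi_metric_on (space M) \<rho> \<and>
     (\<forall>x\<in>space M. \<forall>r>0. qball (space M) \<rho> x r \<in> sets M) \<and>
     (\<exists>L\<ge>1. \<forall>x\<in>space M. \<forall>r>0.
        0 < emeasure M (qball (space M) \<rho> x (2 * r)) \<and>
        emeasure M (qball (space M) \<rho> x (2 * r))
          \<le> ennreal L * emeasure M (qball (space M) \<rho> x r) \<and>
        ennreal L * emeasure M (qball (space M) \<rho> x r) < \<infinity>)"

definition weak_reverse_doubling :: "'a measure \<Rightarrow> ('a \<Rightarrow> 'a \<Rightarrow> real) \<Rightarrow> bool" where
  "weak_reverse_doubling M \<rho> \<longleftrightarrow>
     (\<exists>x\<^sub>0\<in>space M. \<exists>l>1. \<exists>C>1.
        Liminf at_top (\<lambda>r. emeasure M (qball (space M) \<rho> x\<^sub>0 (l * r)) /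
                           emeasure M (qball (space M) \<rho> x\<^sub>0 r)) \<ge> ennreal C)"


section \<open>Growth functions\<close>

definition nearness :: "'a set \<Rightarrow> ('a \<Rightarrow> 'a \<Rightarrow> real) \<Rightarrow> ('a \<Rightarrow> real \<Rightarrow> real) \<Rightarrow> bool" where
  "nearness X \<rho> \<phi> \<longleftrightarrow>
     (\<exists>C>0. \<forall>x\<in>X. \<forall>y\<in>X. \<forall>r>0. \<rho> x y \<le> r \<longrightarrow> 1 / C \<le> \<phi> x r / \<phi> y r \<and> \<phi> x r / \<phi> y r \<le> C)"

definition G1_dec :: "'a measure \<Rightarrow> ('a \<Rightarrow> 'a \<Rightarrow> real) \<Rightarrow> ('a \<Rightarrow> real \<Rightarrow> real) set" where
  "G1_dec M \<rho> = {\<phi>. (\<forall>x\<in>space M. \<forall>r>0. 0 < \<phi> x r) \<and>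
     (\<exists>C>0. \<forall>x\<in>space M. \<forall>r>0. \<forall>s>r.
        measure M (qball (space M) \<rho> x r) * \<phi> x r
          \<le> C * (measure M (qball (space M) \<rho> x s) * \<phi> x s) \<and>
        \<phi> x s \<le> C * \<phi> x r)}"

text \<open>Functions on \<open>[0,\<infinity>)\<close> are represented by functions on \<^typ>\<open>real\<close>; values at negative
  arguments are irrelevant.\<close>

definition orlicz_function :: "(real \<Rightarrow> real) \<Rightarrow> bool" where
  "orlicz_function \<Phi> \<longleftrightarrow>
     mono_on {0..} \<Phi> \<and> \<Phi> 0 = 0 \<and> (\<forall>t>0. 0 < \<Phi> t) \<and> filterlim \<Phi> at_top at_top"

definition lower_type :: "(real \<Rightarrow> real) \<Rightarrow> real \<Rightarrow> bool" where
  "lower_type \<Phi> r \<longleftrightarrow>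
     (\<exists>C\<ge>1. \<forall>t>0. \<forall>s. 0 < s \<and> s < 1 \<longrightarrow> \<Phi> (s * t) \<le> C * s powr r * \<Phi> t)"

definition upper_type :: "(real \<Rightarrow> real) \<Rightarrow> real \<Rightarrow> bool" where
  "upper_type \<Phi> r \<longleftrightarrow>
     (\<exists>C\<ge>1. \<forall>t>0. \<forall>s>1. \<Phi> (s * t) \<le> C * s powr r * \<Phi> t)"


section \<open>Generalized Orlicz--Morrey spaces\<close>

text \<open>Balls of a quasi-metric need not be open, so the maximal function of a measurable function
  need not be measurable with respect to \<^term>\<open>sets M\<close>. Since \<^const>\<open>nn_integral\<close> is a lower
  integral on non-measurable functions, the norms below use the upper integral, which
  agrees with \<^const>\<open>nn_integral\<close> on measurable functions.\<close>

definition upper_nn_integral :: "'a measure \<Rightarrow> ('a \<Rightarrow> ennreal) \<Rightarrow> ennreal" where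
  "upper_nn_integral M g =
     (INF h\<in>{h \<in> borel_measurable M. \<forall>x\<in>space M. g x \<le> h x}. \<integral>\<^sup>+x. h x \<partial>M)"

lemma upper_nn_integral_measurable:
  assumes "g \<in> borel_measurable M"
  shows "upper_nn_integral M g = (\<integral>\<^sup>+x. g x \<partial>M)"
  unfolding upper_nn_integral_def
  using assms by (intro antisym INF_lower INF_greatest) (auto intro: nn_integral_mono)

text \<open>Functions take values in \<^typ>\<open>ereal\<close> because a maximal function may be infinite at some
  points. Accordingly \<open>\<Phi>\<close> is extended by \<open>\<Phi>(\<infinity>) = \<infinity>\<close>, its limit at infinity.\<close>

definition orlicz_ext :: "(real \<Rightarrow> real) \<Rightarrow> ennreal \<Rightarrow> ennreal" where
  "orlicz_ext \<Phi> t = (if t = \<infinity> then \<infinity> else ennreal (\<Phi> (enn2real t)))"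

definition orlicz_norm :: "'a measure \<Rightarrow> (real \<Rightarrow> real) \<Rightarrow> ('a \<Rightarrow> ereal) \<Rightarrow> ennreal" where
  "orlicz_norm M \<Phi> f =
     Inf {ennreal l | l. 0 < l \<and>
       upper_nn_integral M (\<lambda>x. orlicz_ext \<Phi> (e2ennreal \<bar>f x\<bar> / ennreal l)) \<le> 1}"

definition orlicz_loc ::
  "'a measure \<Rightarrow> ('a \<Rightarrow> 'a \<Rightarrow> real) \<Rightarrow> (real \<Rightarrow> real) \<Rightarrow> ('a \<Rightarrow> ereal) set" where
  "orlicz_loc M \<rho> \<Phi> = {f \<in> borel_measurable M.
     \<forall>x\<in>space M. \<exists>r>0.
       orlicz_norm M \<Phi> (\<lambda>y. f y * indicator (qball (space M) \<rho> x r) y) < \<infinity>}"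

definition orlicz_morrey_ball_norm ::
  "'a measure \<Rightarrow> ('a \<Rightarrow> 'a \<Rightarrow> real) \<Rightarrow> (real \<Rightarrow> real) \<Rightarrow> ('a \<Rightarrow> real \<Rightarrow> real)
     \<Rightarrow> 'a \<Rightarrow> real \<Rightarrow> ('a \<Rightarrow> ereal) \<Rightarrow> ennreal" where
  "orlicz_morrey_ball_norm M \<rho> \<Phi> \<phi> x r f =
     Inf {ennreal l | l. 0 < l \<and>
       upper_nn_integral M (\<lambda>y. orlicz_ext \<Phi> (e2ennreal \<bar>f y\<bar> / ennreal l)
                                  * indicator (qball (space M) \<rho> x r) y)
         / emeasure M (qball (space M) \<rho> x r) \<le> ennreal (\<phi> x r)}"

definition orlicz_morrey_norm ::
  "'a measure \<Rightarrow> ('a \<Rightarrow> 'a \<Rightarrow> real) \<Rightarrow> (real \<Rightarrow> real) \<Rightarrow> ('a \<Rightarrow> real \<Rightarrow> real)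
     \<Rightarrow> ('a \<Rightarrow> ereal) \<Rightarrow> ennreal" where
  "orlicz_morrey_norm M \<rho> \<Phi> \<phi> f =
     (SUP (x, r)\<in>space M \<times> {0<..}. orlicz_morrey_ball_norm M \<rho> \<Phi> \<phi> x r f)"

definition orlicz_morrey_space ::
  "'a measure \<Rightarrow> ('a \<Rightarrow> 'a \<Rightarrow> real) \<Rightarrow> (real \<Rightarrow> real) \<Rightarrow> ('a \<Rightarrow> real \<Rightarrow> real)
     \<Rightarrow> ('a \<Rightarrow> ereal) set" where
  "orlicz_morrey_space M \<rho> \<Phi> \<phi> =
     {f \<in> orlicz_loc M \<rho> \<Phi>. orlicz_morrey_norm M \<rho> \<Phi> \<phi> f < \<infinity>}"


section \<open>The Hardy--Littlewood maximal operator\<close>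

definition hl_maximal ::
  "'a measure \<Rightarrow> ('a \<Rightarrow> 'a \<Rightarrow> real) \<Rightarrow> ('a \<Rightarrow> ereal) \<Rightarrow> 'a \<Rightarrow> ereal" where
  "hl_maximal M \<rho> f x = enn2ereal
     (SUP (z, r)\<in>{(z, r). z \<in> space M \<and> 0 < r \<and> x \<in> qball (space M) \<rho> z r}.
        (\<integral>\<^sup>+y\<in>qball (space M) \<rho> z r. e2ennreal \<bar>f y\<bar> \<partial>M)
          / emeasure M (qball (space M) \<rho> z r))"

end

theory Submission
  imports Defs
begin

text \<open>
  After replacing \<open>f\<close> by \<open>u = |f| / l\<close>, with \<open>l\<close> above the norm of \<open>f\<close>, the averages of \<open>\<Phi>(u)\<close>
  over balls \<open>B(x, s)\<close> are at most \<open>\<phi>(x, s)\<close>. The task is to show, on a fixed ball \<open>B(x, r)\<close>, that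
  the average of \<open>\<Phi>(\<M> u)\<close> is at most a constant times \<open>v = \<phi>(x, r)\<close>; since
  \<open>\<Phi>(\<tau> / k) \<le> C \<Phi>(\<tau>) / k\<close>, the constant is then absorbed into the norm
  (\<open>ext_divide_le\<close>, \<open>maximal_morrey_bound\<close>).

  Large and small balls contribute to \<open>\<M> u\<close> in different ways. Choose \<open>a\<close> with \<open>\<Phi>(a)\<close> comparable
  to \<open>v\<close>. The numbers \<open>\<phi>(x, s)\<close>, \<open>s \<ge> r\<close>, are at most a constant times \<open>v\<close>, and \<open>\<Phi>(t) / t\<close>
  almost increases, so the averages of \<open>u\<close> over the balls \<open>B(x, s)\<close> are bounded by a multiple of
  \<open>a\<close> (\<open>average_le_of_ext_average\<close>). By doubling the same holds, with a larger multiple \<open>A\<close> of \<open>a\<close>,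
  for every ball of radius at least \<open>r\<close> that meets \<open>B(x, r)\<close> (\<open>large_ball_average\<close>).

  Hence where \<open>\<M> u\<close> exceeds \<open>A\<close> only balls of radius below \<open>r\<close> matter, and these stay in a fixed
  dilate \<open>B*\<close> of \<open>B(x, r)\<close>. The Vitali covering argument gives the truncated weak type bound
  \<open>t \<mu>{\<M> u > 2 t} \<le> D \<integral> u 1{u > t}\<close> over \<open>B*\<close> for \<open>t \<ge> A\<close> (\<open>maximal_level_set\<close>). Summing it over
  the levels \<open>t = 2^k A\<close> with weights \<open>\<Phi>(4 t) / t\<close> gives a multiple of the integral of \<open>\<Phi>(u)\<close>
  over \<open>B*\<close>: at a point where \<open>u = \<tau>\<close> the terms with \<open>t < \<tau>\<close> decay like
  \<open>(t / \<tau>) powr (p - 1)\<close>, where \<open>p > 1\<close> is the lower type (\<open>level_sum_le_ext\<close>). This is the only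
  place where \<open>p = 1\<close> would fail. Working with \<open>u\<close> on \<open>B*\<close> from level \<open>A\<close> on replaces the usual
  splitting of \<open>f\<close> into a local and a distant part.

  The level sets of \<open>\<M> u\<close> need not be measurable; each is enclosed in the measurable union
  of countably many dilated balls, which is what the upper integral in the norm asks for.
\<close>

section \<open>Covering by balls in a doubling quasi-metric space\<close>

text \<open>The radii need not attain their supremum, so one cannot simply pick a largest set. Instead Zorn's
  lemma is applied to the disjoint subfamilies that already contain a member of at least half the
  radius for every set of \<open>I\<close> they meet. In a maximal one no set of \<open>I\<close> is left untouched:
  among the untouched sets, one of more than half the supremum of the radii could be added.\<close>

lemma vitali_covering_abstract:
  fixes D :: "'i \<Rightarrow> 'a set" and rad :: "'i \<Rightarrow> real"
  assumes nonempty: "\<And>i. i \<in> I \<Longrightarrow> D i \<noteq> {}"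
    and rad_pos: "\<And>i. i \<in> I \<Longrightarrow> 0 < rad i"
    and rad_bdd: "\<And>i. i \<in> I \<Longrightarrow> rad i \<le> R"
  obtains J where "J \<subseteq> I" "disjoint_family_on D J"
    "\<And>i. i \<in> I \<Longrightarrow> \<exists>j\<in>J. D i \<inter> D j \<noteq> {} \<and> rad i \<le> 2 * rad j"
proof -
  define good where "good J \<longleftrightarrow> J \<subseteq> I \<and> disjoint_family_on D J \<and>
    (\<forall>i\<in>I. (\<exists>j\<in>J. D i \<inter> D j \<noteq> {}) \<longrightarrow> (\<exists>j\<in>J. D i \<inter> D j \<noteq> {} \<and> rad i \<le> 2 * rad j))" for J
  have "\<exists>J\<in>Collect good. \<forall>J'\<in>Collect good. J \<subseteq> J' \<longrightarrow> J' = J"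
  proof (rule subset_Zorn')
    fix C assume C: "subset.chain (Collect good) C"
    then have mem: "\<And>J. J \<in> C \<Longrightarrow> good J"
      and tot: "\<And>J J'. J \<in> C \<Longrightarrow> J' \<in> C \<Longrightarrow> J \<subseteq> J' \<or> J' \<subseteq> J"
      by (auto simp: subset_chain_def)
    have "disjoint_family_on D (\<Union>C)"
      unfolding disjoint_family_on_def
    proof (intro ballI impI)
      fix m n assume "m \<in> \<Union>C" "n \<in> \<Union>C" "m \<noteq> n"
      then obtain J where "J \<in> C" "m \<in> J" "n \<in> J" using tot by blast
      then show "D m \<inter> D n = {}"
        using mem[of J] \<open>m \<noteq> n\<close> by (auto simp: good_def disjoint_family_on_def)
    qed
    moreover have "\<Union>C \<subseteq> I" using mem by (simp add: good_def Union_least)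
    moreover have "\<forall>i\<in>I. (\<exists>j\<in>\<Union>C. D i \<inter> D j \<noteq> {}) \<longrightarrow>
        (\<exists>j\<in>\<Union>C. D i \<inter> D j \<noteq> {} \<and> rad i \<le> 2 * rad j)"
      using mem unfolding good_def by (metis Union_iff)
    ultimately show "\<Union>C \<in> Collect good" by (simp add: good_def)
  qed
  then obtain J where J: "good J" and max: "\<And>J'. good J' \<Longrightarrow> J \<subseteq> J' \<Longrightarrow> J' = J"
    by blast
  have meets: "\<exists>j\<in>J. D i \<inter> D j \<noteq> {}" if i: "i \<in> I" for i
  proof (rule ccontr)
    assume no: "\<not> (\<exists>j\<in>J. D i \<inter> D j \<noteq> {})"
    define F where "F = {k \<in> I. \<forall>j\<in>J. D k \<inter> D j = {}}"
    have F: "F \<noteq> {}" "F \<subseteq> I" using i no by (auto simp: F_def)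
    have bdd: "bdd_above (rad ` F)"
      using rad_bdd F(2) by (intro bdd_aboveI[of _ R]) auto
    have "0 < (SUP k\<in>F. rad k)"
    proof -
      obtain k where "k \<in> F" using F by auto
      then show ?thesis using cSUP_upper[OF _ bdd, of k] rad_pos[of k] F(2) by force
    qed
    then have "(SUP k\<in>F. rad k) / 2 < (SUP k\<in>F. rad k)" by simp
    then obtain k where k: "k \<in> F" "(SUP k\<in>F. rad k) / 2 < rad k"
      using less_cSUP_iff[OF F(1) bdd] by auto
    have kbig: "rad k' \<le> 2 * rad k" if "k' \<in> F" for k'
      using cSUP_upper[OF that bdd] k(2) by simp
    have "good (insert k J)"
      unfolding good_def
    proof (intro conjI ballI impI)
      show "insert k J \<subseteq> I" using J k F by (auto simp: good_def)
      show "disjoint_family_on D (insert k J)"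
        using J k by (auto simp: good_def disjoint_family_on_def F_def)
      fix i' assume i': "i' \<in> I" "\<exists>j\<in>insert k J. D i' \<inter> D j \<noteq> {}"
      show "\<exists>j\<in>insert k J. D i' \<inter> D j \<noteq> {} \<and> rad i' \<le> 2 * rad j"
      proof (cases "\<exists>j\<in>J. D i' \<inter> D j \<noteq> {}")
        case True
        then show ?thesis using J i' unfolding good_def by blast
      next
        case False
        then have "i' \<in> F" "D i' \<inter> D k \<noteq> {}" using i' by (auto simp: F_def)
        then show ?thesis using kbig by blast
      qed
    qed
    then have "k \<in> J" using max by blast
    then show False using k(1) nonempty[of k] by (auto simp: F_def)
  qed
  show thesis
    by (rule that[of J]) (use J meets in \<open>auto simp: good_def\<close>)
qed

text \<open>Finite subfamilies have total measure at most that of \<open>Q\<close>, so the measures are summable, and a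
  summable family has only countably many nonzero terms.\<close>

lemma countable_disjoint_positive_measure:
  assumes Q: "Q \<in> sets M" "emeasure M Q < \<infinity>"
    and D: "\<And>i. i \<in> J \<Longrightarrow> D i \<in> sets M" "\<And>i. i \<in> J \<Longrightarrow> D i \<subseteq> Q"
    and pos: "\<And>i. i \<in> J \<Longrightarrow> 0 < emeasure M (D i)"
    and disj: "disjoint_family_on D J"
  shows "countable J"
proof -
  have fin: "emeasure M (D i) < \<infinity>" if "i \<in> J" for i
    using emeasure_mono[OF D(2)[OF that] Q(1)] Q(2) by simp
  have "(\<lambda>i. measure M (D i)) summable_on J"
  proof (rule nonneg_bdd_above_summable_on)
    show "bdd_above (sum (\<lambda>i. measure M (D i)) ` {F. F \<subseteq> J \<and> finite F})"
    proof (rule bdd_aboveI2[where M = "measure M Q"])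
      fix F assume F: "F \<in> {F. F \<subseteq> J \<and> finite F}"
      have "(\<Sum>i\<in>F. measure M (D i)) = measure M (\<Union>i\<in>F. D i)"
        using F D fin disj
        by (intro measure_finite_Union[symmetric])
          (auto simp: top.not_eq_extremum intro: disjoint_family_on_mono)
      also have "\<dots> \<le> measure M Q"
        using F D Q by (intro measure_mono_fmeasurable sets.finite_UN) (auto simp: fmeasurable_def)
      finally show "(\<Sum>i\<in>F. measure M (D i)) \<le> measure M Q" .
    qed
  qed auto
  then have "countable {i\<in>J. measure M (D i) \<noteq> 0}" by (rule summable_countable_real)
  moreover have "{i\<in>J. measure M (D i) \<noteq> 0} = J"
    using pos fin by (force simp: measure_def enn2real_eq_0_iff)
  ultimately show ?thesis by simp
qed

text \<open>A space of homogeneous type with its two constants made explicit, so that later bounds can name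
  what they depend on.\<close>

locale doubling_space =
  fixes M :: "'a measure" and \<rho> :: "'a \<Rightarrow> 'a \<Rightarrow> real" and K L :: real
  assumes sym: "\<And>x y. x \<in> space M \<Longrightarrow> y \<in> space M \<Longrightarrow> \<rho> x y = \<rho> y x"
    and self: "\<And>x. x \<in> space M \<Longrightarrow> \<rho> x x = 0"
    and K_ge_1: "1 \<le> K"
    and triangle: "\<And>x y z. x \<in> space M \<Longrightarrow> y \<in> space M \<Longrightarrow> z \<in> space M \<Longrightarrow>
      \<rho> x z \<le> K * (\<rho> x y + \<rho> y z)"
    and ball_sets [measurable, simp]: "\<And>x r. x \<in> space M \<Longrightarrow> 0 < r \<Longrightarrow> qball (space M) \<rho> x r \<in> sets M"
    and L_ge_1: "1 \<le> L"
    and ball_pos: "\<And>x r. x \<in> space M \<Longrightarrow> 0 < r \<Longrightarrow> 0 < emeasure M (qball (space M) \<rho> x r)"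
    and ball_fin: "\<And>x r. x \<in> space M \<Longrightarrow> 0 < r \<Longrightarrow> emeasure M (qball (space M) \<rho> x r) < \<infinity>"
    and doubling: "\<And>x r. x \<in> space M \<Longrightarrow> 0 < r \<Longrightarrow>
      emeasure M (qball (space M) \<rho> x (2 * r)) \<le> ennreal L * emeasure M (qball (space M) \<rho> x r)"
begin

abbreviation B :: "'a \<Rightarrow> real \<Rightarrow> 'a set" where "B \<equiv> qball (space M) \<rho>"

text \<open>A single dilation factor \<open>\<kappa>\<close> serves all purposes: \<open>5 K\<^sup>2\<close> is what \<open>ball_engulf\<close> needs, and taking a
  power of two lets the doubling condition be iterated. \<open>D\<close> is the resulting doubling constant for
  dilation by \<open>\<kappa>\<close>.\<close>

definition dil_exp :: nat where "dil_exp = (SOME n. 5 * K\<^sup>2 \<le> 2 ^ n)"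

definition \<kappa> :: real where "\<kappa> = 2 ^ dil_exp"

definition D :: real where "D = L ^ dil_exp"

lemma kappa_ge: "5 * K\<^sup>2 \<le> \<kappa>"
proof -
  have "\<exists>n. 5 * K\<^sup>2 \<le> 2 ^ n"
    using real_arch_pow[of 2 "5 * K\<^sup>2"] less_imp_le by auto
  then show ?thesis unfolding \<kappa>_def dil_exp_def by (rule someI_ex)
qed

lemma kappa_ge_1: "1 \<le> \<kappa>" and kappa_pos: "0 < \<kappa>"
  by (simp_all add: \<kappa>_def)

lemma D_ge_1: "1 \<le> D"
  using L_ge_1 by (simp add: D_def)

lemma ball_mono: "r \<le> s \<Longrightarrow> B x r \<subseteq> B x s"
  by (auto simp: qball_def)

lemma emeasure_dilated_ball:
  assumes "x \<in> space M" "0 < r"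
  shows "emeasure M (B x (\<kappa> * r)) \<le> ennreal D * emeasure M (B x r)"
proof -
  have "emeasure M (B x (2 ^ n * r)) \<le> ennreal (L ^ n) * emeasure M (B x r)" for n
  proof (induction n)
    case (Suc n)
    have "emeasure M (B x (2 ^ Suc n * r)) \<le> ennreal L * emeasure M (B x (2 ^ n * r))"
      using doubling[of x "2 ^ n * r"] assms by (simp add: mult.assoc)
    also have "\<dots> \<le> ennreal L * (ennreal (L ^ n) * emeasure M (B x r))"
      by (intro mult_left_mono Suc) simp
    also have "\<dots> = ennreal (L ^ Suc n) * emeasure M (B x r)"
      using L_ge_1 by (simp add: ennreal_mult mult.assoc)
    finally show ?case .
  qed simp
  then show ?thesis by (simp add: \<kappa>_def D_def)
qed

text \<open>The factor 2 allowed in \<open>s \<le> 2 q\<close> matches the loss in \<open>vitali_covering_abstract\<close>. Passing from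
  \<open>w\<close> to a common point \<open>x\<close>, to \<open>z\<close>, to \<open>y\<close> uses the quasi-triangle inequality twice, which gives
  \<open>K q + 4 K\<^sup>2 q\<close>.\<close>

lemma ball_engulf:
  assumes z: "z \<in> space M" and w: "w \<in> space M"
    and meet: "B z s \<inter> B w q \<noteq> {}" and s: "s \<le> 2 * q" and q: "0 < q"
  shows "B z s \<subseteq> B w (\<kappa> * q)"
proof
  fix y assume "y \<in> B z s"
  then have y: "y \<in> space M" "\<rho> z y < s" by (auto simp: qball_def)
  obtain x where x: "x \<in> space M" "\<rho> z x < s" "\<rho> w x < q"
    using meet by (auto simp: qball_def)
  have K: "0 < K" using K_ge_1 by simp
  have "\<rho> w y \<le> K * (\<rho> w x + \<rho> x y)" using triangle w x y by simp
  also have "\<dots> \<le> K * (\<rho> w x + K * (\<rho> x z + \<rho> z y))"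
    using triangle[of x z y] x y z K by (simp add: mult_left_mono)
  also have "\<dots> < K * (q + K * (2 * q + 2 * q))"
  proof -
    have "\<rho> x z + \<rho> z y \<le> 2 * q + 2 * q" using x y z sym[of x z] s by simp
    then have "K * (\<rho> x z + \<rho> z y) \<le> K * (2 * q + 2 * q)"
      by (rule mult_left_mono) (use K in simp)
    then have "\<rho> w x + K * (\<rho> x z + \<rho> z y) < q + K * (2 * q + 2 * q)"
      using x(3) by linarith
    then show ?thesis using K by (rule mult_strict_left_mono)
  qed
  also have "\<dots> = K * 1 * q + 4 * K\<^sup>2 * q" by (simp add: power2_eq_square algebra_simps)
  also have "\<dots> \<le> K * K * q + 4 * K\<^sup>2 * q"
    using K_ge_1 q by (intro add_right_mono mult_right_mono mult_left_mono) auto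
  also have "\<dots> = 5 * K\<^sup>2 * q" by (simp add: power2_eq_square algebra_simps)
  also have "\<dots> \<le> \<kappa> * q" using kappa_ge q by (intro mult_right_mono) auto
  finally show "y \<in> B w (\<kappa> * q)" using y by (auto simp: qball_def)
qed

text \<open>Disjoint balls selected by the covering lemma have total measure at most the integral of \<open>g\<close>
  over \<open>Q\<close>, up to the factor \<open>t\<close>, and their dilates cover all the given balls. The set \<open>E\<close>
  is the union of these dilates; it stands in for the union of the given balls,
  which may fail to be measurable.\<close>

lemma vitali_weak_type:
  assumes g [measurable]: "g \<in> borel_measurable M"
    and Q: "Q \<in> sets M" "emeasure M Q < \<infinity>"
    and I: "\<And>z s. (z, s) \<in> I \<Longrightarrow> z \<in> space M \<and> 0 < s \<and> s \<le> R \<and> B z s \<subseteq> Q"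
    and avg: "\<And>z s. (z, s) \<in> I \<Longrightarrow> t * emeasure M (B z s) \<le> (\<integral>\<^sup>+x\<in>B z s. g x \<partial>M)"
  shows "\<exists>E\<in>sets M. (\<Union>(z, s)\<in>I. B z s) \<subseteq> E \<and>
    t * emeasure M E \<le> ennreal D * (\<integral>\<^sup>+x\<in>Q. g x \<partial>M)"
proof -
  define D1 where "D1 = (\<lambda>(z, s). B z s)"
  define D2 where "D2 = (\<lambda>(z, s). B z (\<kappa> * s))"
  have centre: "z \<in> B z s" if "z \<in> space M" "0 < s" for z s
    using self that by (simp add: qball_def)
  obtain J where J: "J \<subseteq> I" "disjoint_family_on D1 J"
    and cover: "\<And>i. i \<in> I \<Longrightarrow> \<exists>j\<in>J. D1 i \<inter> D1 j \<noteq> {} \<and> snd i \<le> 2 * snd j"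
  proof (rule vitali_covering_abstract[of I D1 snd R])
    show "D1 i \<noteq> {}" "0 < snd i" "snd i \<le> R" if "i \<in> I" for i
      using that I[of "fst i" "snd i"] centre[of "fst i" "snd i"] by (auto simp: D1_def split_beta)
  qed blast
  have J_I: "fst j \<in> space M" "0 < snd j" "D1 j \<subseteq> Q" "D1 j \<in> sets M" "D2 j \<in> sets M"
      "t * emeasure M (D1 j) \<le> (\<integral>\<^sup>+x\<in>D1 j. g x \<partial>M)"
      "emeasure M (D2 j) \<le> ennreal D * emeasure M (D1 j)" "0 < emeasure M (D1 j)"
    if "j \<in> J" for j
    using that J(1) I[of "fst j" "snd j"] avg[of "fst j" "snd j"] kappa_pos
      emeasure_dilated_ball[of "fst j" "snd j"] ball_pos[of "fst j" "snd j"]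
    by (auto simp: D1_def D2_def split_beta)
  have cnt: "countable J"
    using J_I Q J(2) by (intro countable_disjoint_positive_measure[of Q M J D1]) auto
  define E where "E = (\<Union>j\<in>J. D2 j)"
  have E [measurable]: "E \<in> sets M"
    unfolding E_def using J_I(5) cnt by (intro sets.countable_UN') auto
  have "(\<Union>(z, s)\<in>I. B z s) \<subseteq> E"
  proof (clarify)
    fix x z s assume zs: "(z, s) \<in> I" and x: "x \<in> B z s"
    obtain j where j: "j \<in> J" "D1 (z, s) \<inter> D1 j \<noteq> {}" "s \<le> 2 * snd j" using cover[OF zs] by auto
    have "B z s \<subseteq> B (fst j) (\<kappa> * snd j)"
      using j J_I[OF j(1)] I[OF zs] by (intro ball_engulf) (auto simp: D1_def split_beta)
    then show "x \<in> E" using x j(1) by (auto simp: E_def D2_def split_beta)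
  qed
  moreover have "t * emeasure M E \<le> ennreal D * (\<integral>\<^sup>+x\<in>Q. g x \<partial>M)"
  proof -
    \<comment> \<open>Sums over \<open>J\<close> are integrals against the counting measure, so that subadditivity over \<open>J\<close>
      and the disjointness bound both become an exchange of two integrals.\<close>
    have "emeasure M E = (\<integral>\<^sup>+x. indicator E x \<partial>M)" by simp
    also have "\<dots> \<le> (\<integral>\<^sup>+x. (\<integral>\<^sup>+j. indicator (D2 j) x \<partial>count_space J) \<partial>M)"
    proof (intro nn_integral_mono)
      fix x
      show "indicator E x \<le> (\<integral>\<^sup>+j. indicator (D2 j) x \<partial>count_space J)"
      proof (cases "x \<in> E")
        case True
        then obtain j where "j \<in> J" "x \<in> D2 j" by (auto simp: E_def)
        then have "indicator E x = (\<integral>\<^sup>+i. indicator {j} i \<partial>count_space J)"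
          using True by simp
        also have "\<dots> \<le> (\<integral>\<^sup>+i. indicator (D2 i) x \<partial>count_space J)"
          using \<open>x \<in> D2 j\<close> by (intro nn_integral_mono) (auto split: split_indicator)
        finally show ?thesis .
      qed simp
    qed
    also have "\<dots> = (\<integral>\<^sup>+j. (\<integral>\<^sup>+x. indicator (D2 j) x \<partial>M) \<partial>count_space J)"
      using J_I(5) by (intro nn_integral_count_space_nn_integral cnt) auto
    also have "\<dots> = (\<integral>\<^sup>+j. emeasure M (D2 j) \<partial>count_space J)"
      using J_I(5) by (intro nn_integral_cong) auto
    finally have "t * emeasure M E \<le> t * (\<integral>\<^sup>+j. emeasure M (D2 j) \<partial>count_space J)"
      by (rule mult_left_mono) simp
    also have "\<dots> = (\<integral>\<^sup>+j. t * emeasure M (D2 j) \<partial>count_space J)"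
      by (simp add: nn_integral_cmult)
    also have "\<dots> \<le> (\<integral>\<^sup>+j. ennreal D * (\<integral>\<^sup>+x\<in>D1 j. g x \<partial>M) \<partial>count_space J)"
    proof (intro nn_integral_mono)
      fix j assume "j \<in> space (count_space J)"
      then have j: "j \<in> J" by simp
      have "t * emeasure M (D2 j) \<le> t * (ennreal D * emeasure M (D1 j))"
        by (intro mult_left_mono J_I j) simp
      also have "\<dots> = ennreal D * (t * emeasure M (D1 j))" by (simp add: mult_ac)
      also have "\<dots> \<le> ennreal D * (\<integral>\<^sup>+x\<in>D1 j. g x \<partial>M)"
        by (intro mult_left_mono J_I j) simp
      finally show "t * emeasure M (D2 j) \<le> ennreal D * (\<integral>\<^sup>+x\<in>D1 j. g x \<partial>M)" .
    qed
    also have "\<dots> = ennreal D * (\<integral>\<^sup>+j. (\<integral>\<^sup>+x\<in>D1 j. g x \<partial>M) \<partial>count_space J)"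
      by (simp add: nn_integral_cmult)
    also have "\<dots> \<le> ennreal D * (\<integral>\<^sup>+x\<in>Q. g x \<partial>M)"
    proof (rule mult_left_mono)
      have "(\<integral>\<^sup>+j. (\<integral>\<^sup>+x\<in>D1 j. g x \<partial>M) \<partial>count_space J)
          = (\<integral>\<^sup>+x. (\<integral>\<^sup>+j. g x * indicator (D1 j) x \<partial>count_space J) \<partial>M)"
        using J_I(4) by (intro nn_integral_count_space_nn_integral[symmetric] cnt) auto
      also have "\<dots> \<le> (\<integral>\<^sup>+x\<in>Q. g x \<partial>M)"
      proof (intro nn_integral_mono)
        fix x
        show "(\<integral>\<^sup>+j. g x * indicator (D1 j) x \<partial>count_space J) \<le> g x * indicator Q x"
        proof (cases "\<exists>j\<in>J. x \<in> D1 j")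
          case True
          then obtain j where j: "j \<in> J" "x \<in> D1 j" by auto
          have "(\<integral>\<^sup>+i. g x * indicator (D1 i) x \<partial>count_space J)
              = (\<integral>\<^sup>+i. g x * indicator {j} i \<partial>count_space J)"
            using j J(2) by (intro nn_integral_cong) (auto simp: disjoint_family_on_def split: split_indicator)
          also have "\<dots> = g x" using j by (simp add: nn_integral_cmult)
          also have "\<dots> = g x * indicator Q x" using J_I(3)[OF j(1)] j(2) by auto
          finally show ?thesis by simp
        next
          case False
          then have "(\<integral>\<^sup>+i. g x * indicator (D1 i) x \<partial>count_space J) = (\<integral>\<^sup>+i. 0 \<partial>count_space J)"
            by (intro nn_integral_cong) auto
          then show ?thesis by simp
        qed
      qed
      finally show "(\<integral>\<^sup>+j. (\<integral>\<^sup>+x\<in>D1 j. g x \<partial>M) \<partial>count_space J) \<le> (\<integral>\<^sup>+x\<in>Q. g x \<partial>M)" .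
    qed simp
    finally show ?thesis .
  qed
  ultimately show ?thesis using E by blast
qed

end

section \<open>Orlicz functions of lower type above one\<close>

text \<open>The terms grow geometrically until they reach 1, so the last one dominates. The bound
  \<open>min (q ^ n * h) q / (q - 1)\<close> is kept along the induction: it is the value of the geometric
  series summed from \<open>-\<infinity>\<close> up to, but excluding, index \<open>n\<close> as long as the terms are
  below 1, and afterwards it does not decrease.\<close>

lemma geometric_sum_below_threshold:
  fixes q h :: real
  assumes q: "1 < q" and h: "0 \<le> h"
  shows "(\<Sum>k<n. if q ^ k * h < 1 then q ^ k * h else 0) \<le> q / (q - 1)"
proof -
  have "(\<Sum>k<n. if q ^ k * h < 1 then q ^ k * h else 0) \<le> min (q ^ n * h) q / (q - 1)"
  proof (induction n)
    case 0
    then show ?case using q h by simp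
  next
    case (Suc n)
    show ?case
    proof (cases "q ^ n * h < 1")
      case True
      then have "(\<Sum>k<Suc n. if q ^ k * h < 1 then q ^ k * h else 0)
          \<le> q ^ n * h / (q - 1) + q ^ n * h"
        using Suc q by (simp add: min_def)
      also have "\<dots> = q ^ Suc n * h / (q - 1)" using q by (simp add: field_simps)
      also have "\<dots> = min (q ^ Suc n * h) q / (q - 1)"
        using True q by (simp add: min_def mult.assoc)
      finally show ?thesis .
    next
      case False
      have "q ^ n * h \<le> q ^ Suc n * h" using q h by (simp add: mult_right_mono)
      then have "min (q ^ n * h) q / (q - 1) \<le> min (q ^ Suc n * h) q / (q - 1)"
        using q by (intro divide_right_mono min.mono) auto
      then show ?thesis using Suc False by simp
    qed
  qed
  also have "\<dots> \<le> q / (q - 1)" using q by (intro divide_right_mono) auto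
  finally show ?thesis .
qed

text \<open>In the application \<open>p\<close> and \<open>q\<close> are the lower and the upper type. Since \<open>p > 1\<close>, the lower type
  already says that \<open>\<Phi>(t) / t\<close> is increasing up to the factor \<open>C1\<close>; this takes the place of
  Jensen's inequality below.\<close>

locale orlicz_power_type =
  fixes \<Phi> :: "real \<Rightarrow> real" and p q C1 C2 :: real
  assumes mono: "mono_on {0..} \<Phi>" and zero: "\<Phi> 0 = 0" and pos: "\<And>t. 0 < t \<Longrightarrow> 0 < \<Phi> t"
    and at_top: "filterlim \<Phi> at_top at_top"
    and p_gt_1: "1 < p" and C1_ge_1: "1 \<le> C1" and C2_ge_1: "1 \<le> C2"
    and lower: "\<And>t s. 0 < t \<Longrightarrow> 0 < s \<Longrightarrow> s < 1 \<Longrightarrow> \<Phi> (s * t) \<le> C1 * s powr p * \<Phi> t"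
    and upper: "\<And>t s. 0 < t \<Longrightarrow> 1 < s \<Longrightarrow> \<Phi> (s * t) \<le> C2 * s powr q * \<Phi> t"
begin

lemma mono': "0 \<le> s \<Longrightarrow> s \<le> t \<Longrightarrow> \<Phi> s \<le> \<Phi> t"
  using mono by (auto simp: mono_on_def)

lemma nonneg: "0 \<le> t \<Longrightarrow> 0 \<le> \<Phi> t"
  using mono'[of 0 t] zero by simp

lemma ext_ennreal: "0 \<le> t \<Longrightarrow> orlicz_ext \<Phi> (ennreal t) = ennreal (\<Phi> t)"
  by (simp add: orlicz_ext_def)

lemma ext_top [simp]: "orlicz_ext \<Phi> top = top"
  by (simp add: orlicz_ext_def)

lemma ext_mono: "s \<le> t \<Longrightarrow> orlicz_ext \<Phi> s \<le> orlicz_ext \<Phi> t"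
  by (cases s; cases t) (auto simp: ext_ennreal top_unique intro: ennreal_leI mono')

lemma ext_measurable [measurable]: "orlicz_ext \<Phi> \<in> borel_measurable borel"
proof -
  have "mono (\<lambda>t. \<Phi> (max 0 t))" by (auto intro!: monoI mono')
  then have [measurable]: "(\<lambda>t. \<Phi> (max 0 t)) \<in> borel_measurable borel" by (rule borel_measurable_mono)
  have "orlicz_ext \<Phi> = (\<lambda>t. if t = \<infinity> then \<infinity> else ennreal (\<Phi> (max 0 (enn2real t))))"
    by (auto simp: orlicz_ext_def fun_eq_iff max_def)
  then show ?thesis by simp
qed

lemma lower_linear: "0 < t \<Longrightarrow> 0 < s \<Longrightarrow> s < 1 \<Longrightarrow> \<Phi> (s * t) \<le> C1 * s * \<Phi> t"
proof -
  assume *: "0 < t" "0 < s" "s < 1"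
  have "s powr p \<le> s powr 1" using * p_gt_1 by (intro powr_mono') auto
  then have "C1 * s powr p * \<Phi> t \<le> C1 * s * \<Phi> t"
    using * C1_ge_1 pos[of t] by (intro mult_right_mono mult_left_mono) auto
  then show ?thesis using lower[OF *] by simp
qed

lemma upper_two: "0 < t \<Longrightarrow> \<Phi> (2 * t) \<le> C2 * 2 powr q * \<Phi> t"
  by (rule upper) auto

text \<open>A continuity-free substitute for solving \<open>\<Phi>(a) = v\<close>: start at a point where \<open>\<Phi>\<close> is below \<open>v\<close>
  and double until just before \<open>v\<close> is passed; one doubling costs at most the upper type factor.\<close>

lemma level_between_dyadic:
  assumes v: "0 < v"
  shows "\<exists>a>0. \<Phi> a \<le> v \<and> v \<le> C2 * 2 powr q * \<Phi> a"
proof -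
  define s where "s = min (1/2) (v / (C1 * \<Phi> 1))"
  have P1: "0 < C1 * \<Phi> 1" using C1_ge_1 pos[of 1] by simp
  have s: "0 < s" "s < 1" "s * (C1 * \<Phi> 1) \<le> v"
    using v P1 by (auto simp: s_def min_def field_simps)
  have start: "\<Phi> s \<le> v" using lower_linear[of 1 s] s by (simp add: mult_ac)
  have "\<exists>N. \<forall>t\<ge>N. v + 1 \<le> \<Phi> t"
    using at_top by (auto simp: filterlim_at_top eventually_at_top_linorder)
  then obtain N where N: "\<And>t. t \<ge> N \<Longrightarrow> v < \<Phi> t" by force
  obtain n :: nat where "N / s < 2 ^ n" using real_arch_pow[of 2 "N / s"] by auto
  then have "N \<le> 2 ^ n * s" using s by (simp add: field_simps)
  then have ex: "v < \<Phi> (2 ^ n * s)" by (rule N)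
  define m where "m = (LEAST n. v < \<Phi> (2 ^ n * s))"
  have m: "v < \<Phi> (2 ^ m * s)" unfolding m_def by (rule LeastI[of _ n]) (rule ex)
  then have "m \<noteq> 0" using start by (auto intro!: Nat.gr0I)
  then obtain k where k: "m = Suc k" using not0_implies_Suc by blast
  have "\<Phi> (2 ^ k * s) \<le> v" using not_less_Least[of k "\<lambda>n. v < \<Phi> (2 ^ n * s)"] k m_def by fastforce
  moreover have "v \<le> C2 * 2 powr q * \<Phi> (2 ^ k * s)"
    using m upper_two[of "2 ^ k * s"] s by (simp add: k mult.assoc)
  ultimately show ?thesis using s by (intro exI[of _ "2 ^ k * s"]) auto
qed

text \<open>Where \<open>u > a\<close>, almost monotonicity of \<open>\<Phi>(t) / t\<close> gives \<open>\<Phi>(a) / a \<le> C1 \<Phi>(u) / u\<close>. Integrated over a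
  ball, this bounds the average of \<open>u\<close> by that of \<open>\<Phi>(u)\<close>.\<close>

lemma le_level_plus_ext:
  assumes a: "0 < a"
  shows "u \<le> ennreal a + ennreal (C1 * a / \<Phi> a) * orlicz_ext \<Phi> u"
proof (cases "u \<le> ennreal a")
  case True
  then show ?thesis by (simp add: add_increasing2)
next
  case False
  have c: "0 < C1 * a / \<Phi> a" using C1_ge_1 a pos[of a] by simp
  show ?thesis
  proof (cases u)
    case top
    have "ennreal (C1 * a / \<Phi> a) \<noteq> 0" using c by (simp only: ennreal_eq_0_iff not_le)
    then have "ennreal (C1 * a / \<Phi> a) * top = top" by (simp only: ennreal_mult_top if_False)
    then show ?thesis by (simp only: ext_top add_top_right_ennreal top_greatest top)
  next
    case (real t)
    then have t: "a < t" using False a by (simp add: ennreal_le_iff2 not_le)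
    have "\<Phi> (a / t * t) \<le> C1 * (a / t) * \<Phi> t"
      using t a by (intro lower_linear) auto
    then have "t \<le> C1 * a / \<Phi> a * \<Phi> t"
      using t a pos[of a] by (simp add: field_simps)
    then have "u \<le> ennreal (C1 * a / \<Phi> a) * orlicz_ext \<Phi> u"
      using real c nonneg[of t] by (simp add: ext_ennreal ennreal_mult[symmetric] ennreal_leI)
    then show ?thesis by (simp add: add_increasing)
  qed
qed

text \<open>Constants in front of a modular can be moved inside \<open>\<Phi>\<close>, which turns a modular estimate
  into an estimate of the Luxemburg-type norm.\<close>

lemma ext_divide_le:
  assumes G: "0 < G" and k: "1 < k" "C1 * G \<le> k"
  shows "orlicz_ext \<Phi> (\<tau> / ennreal k) \<le> ennreal (1 / G) * orlicz_ext \<Phi> \<tau>"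
proof (cases \<tau>)
  case top
  then show ?thesis using G by (simp add: ennreal_mult_top)
next
  case (real t)
  show ?thesis
  proof (cases "t = 0")
    case True
    then show ?thesis using real by (simp add: orlicz_ext_def zero)
  next
    case False
    then have t: "0 < t" using real by simp
    have "\<Phi> (t / k) \<le> C1 * (1 / k) * \<Phi> t" using lower_linear[of t "1 / k"] t k by simp
    also have "\<dots> \<le> 1 / G * \<Phi> t"
      using k G pos[OF t] by (intro mult_right_mono) (auto simp: field_simps)
    finally have "ennreal (\<Phi> (t / k)) \<le> ennreal (1 / G * \<Phi> t)" by (rule ennreal_leI)
    then show ?thesis
      using real k G nonneg[of t]
      by (simp add: divide_ennreal ext_ennreal ennreal_mult[symmetric] del: times_divide_eq_left)
  qed
qed

text \<open>The constant of \<open>level_sum_le_ext\<close>: two doublings for \<open>\<Phi>(4 t)\<close>, the lower type constant, and a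
  geometric series of ratio \<open>2 powr (p - 1)\<close>.\<close>

definition C3 :: real where
  "C3 = (C2 * 2 powr q)\<^sup>2 * C1 * (2 powr (p - 1) / (2 powr (p - 1) - 1))"

lemma two_powr_gt_1: "1 < 2 powr (p - 1)"
  using p_gt_1 by simp

lemma C3_pos: "0 < C3"
  using C1_ge_1 C2_ge_1 two_powr_gt_1 by (simp add: C3_def)

lemma level_term_le:
  assumes t: "0 < t" "t < \<tau>"
  shows "\<Phi> (4 * t) / t * \<tau> \<le> (C2 * 2 powr q)\<^sup>2 * C1 * (t / \<tau>) powr (p - 1) * \<Phi> \<tau>"
proof -
  define c where "c = C2 * 2 powr q"
  have c: "0 < c" using C2_ge_1 by (simp add: c_def)
  have "\<Phi> (4 * t) \<le> c * \<Phi> (2 * t)" using upper_two[of "2 * t"] t by (simp add: c_def)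
  also have "\<dots> \<le> c * (c * \<Phi> t)" using upper_two[of t] t(1) c
    unfolding c_def by (intro mult_left_mono) auto
  also have "\<dots> \<le> c * (c * (C1 * ((t / \<tau>) powr (p - 1) * (t / \<tau>)) * \<Phi> \<tau>))"
  proof (intro mult_left_mono)
    have "\<Phi> t \<le> C1 * (t / \<tau>) powr p * \<Phi> \<tau>" using lower[of \<tau> "t / \<tau>"] t by simp
    also have "(t / \<tau>) powr p = (t / \<tau>) powr (p - 1) * (t / \<tau>)"
      using t by (simp add: powr_diff)
    finally show "\<Phi> t \<le> C1 * ((t / \<tau>) powr (p - 1) * (t / \<tau>)) * \<Phi> \<tau>" .
  qed (use c in simp_all)
  finally have "\<Phi> (4 * t) \<le> c * (c * (C1 * ((t / \<tau>) powr (p - 1) * (t / \<tau>)) * \<Phi> \<tau>))" .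
  then have "\<Phi> (4 * t) * (\<tau> / t) \<le> c * (c * (C1 * ((t / \<tau>) powr (p - 1) * (t / \<tau>)) * \<Phi> \<tau>)) * (\<tau> / t)"
    by (rule mult_right_mono) (use t in simp)
  also have "\<dots> = c\<^sup>2 * C1 * (t / \<tau>) powr (p - 1) * \<Phi> \<tau>"
    using t by (simp add: power2_eq_square)
  finally show ?thesis by (simp add: c_def)
qed

text \<open>The discrete form of the layer cake formula for \<open>\<Phi>\<close>. By \<open>level_term_le\<close> the terms with level below
  \<open>\<tau> = u\<close> are at most \<open>\<Phi>(\<tau>)\<close> times \<open>(t / \<tau>) powr (p - 1)\<close> up to a constant, and these factors form
  a geometric progression that stays below 1.\<close>

lemma level_sum_le_ext:
  assumes A: "0 < A"
  shows "(\<Sum>k. ennreal (\<Phi> (4 * (2 ^ k * A)) / (2 ^ k * A)) *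
      (u * indicator {ennreal (2 ^ k * A)<..} u)) \<le> ennreal C3 * orlicz_ext \<Phi> u"
proof (cases u)
  case top
  then show ?thesis using C3_pos by (simp add: ennreal_mult_top)
next
  case (real \<tau>)
  show ?thesis
  proof (cases "\<tau> = 0")
    case True
    then show ?thesis using real by simp
  next
    case False
    then have \<tau>: "0 < \<tau>" using real by simp
    define Q where "Q = 2 powr (p - 1)"
    define h where "h = (A / \<tau>) powr (p - 1)"
    define c where "c = (C2 * 2 powr q)\<^sup>2 * C1 * \<Phi> \<tau>"
    have c: "0 \<le> c" using C1_ge_1 nonneg[of \<tau>] \<tau> by (simp add: c_def)
    have Qh: "(2 ^ k * A / \<tau>) powr (p - 1) = Q ^ k * h" for k :: nat
      using A \<tau> by (simp add: Q_def h_def powr_mult powr_divide powr_realpow[symmetric] powr_powr mult_ac)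
    define T where "T k = (if Q ^ k * h < 1 then Q ^ k * h else 0)" for k :: nat
    have T: "0 \<le> T k" for k by (simp add: T_def Q_def h_def)
    have "ennreal (\<Phi> (4 * (2 ^ k * A)) / (2 ^ k * A)) * (u * indicator {ennreal (2 ^ k * A)<..} u)
        \<le> ennreal (c * T k)" for k
    proof (cases "2 ^ k * A < \<tau>")
      case True
      then have "(2 ^ k * A / \<tau>) powr (p - 1) < 1 powr (p - 1)"
        using A \<tau> p_gt_1 by (intro powr_less_mono2) auto
      then have Tk: "T k = (2 ^ k * A / \<tau>) powr (p - 1)" using Qh by (simp add: T_def)
      have "ennreal (\<Phi> (4 * (2 ^ k * A)) / (2 ^ k * A)) * (u * indicator {ennreal (2 ^ k * A)<..} u)
          \<le> ennreal (\<Phi> (4 * (2 ^ k * A)) / (2 ^ k * A)) * ennreal \<tau>"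
        using real by (intro mult_left_mono) (auto split: split_indicator)
      also have "\<dots> = ennreal (\<Phi> (4 * (2 ^ k * A)) / (2 ^ k * A) * \<tau>)"
        using A \<tau> nonneg[of "4 * (2 ^ k * A)"] by (intro ennreal_mult[symmetric]) auto
      also have "\<dots> \<le> ennreal (c * T k)"
        using level_term_le[of "2 ^ k * A" \<tau>] True A Tk by (intro ennreal_leI) (simp add: c_def mult_ac)
      finally show ?thesis .
    next
      case False
      then show ?thesis using real \<tau> A by (simp add: ennreal_less_iff)
    qed
    then have "(\<Sum>k. ennreal (\<Phi> (4 * (2 ^ k * A)) / (2 ^ k * A)) *
      (u * indicator {ennreal (2 ^ k * A)<..} u)) \<le> (\<Sum>k. ennreal (c * T k))"
      by (intro suminf_le) auto
    also have "\<dots> \<le> ennreal (c * (Q / (Q - 1)))"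
    proof (rule suminf_le_const)
      fix n
      have "(\<Sum>k<n. ennreal (c * T k)) = ennreal (c * (\<Sum>k<n. T k))"
        using c T by (simp add: sum_distrib_left)
      also have "\<dots> \<le> ennreal (c * (Q / (Q - 1)))"
        using geometric_sum_below_threshold[of Q h n] two_powr_gt_1 c
        by (intro ennreal_leI mult_left_mono) (auto simp: T_def Q_def h_def)
      finally show "(\<Sum>k<n. ennreal (c * T k)) \<le> ennreal (c * (Q / (Q - 1)))" .
    qed simp
    also have "\<dots> = ennreal C3 * orlicz_ext \<Phi> u"
      using real \<tau> C3_pos nonneg[of \<tau>]
      by (simp add: ext_ennreal ennreal_mult[symmetric] C3_def c_def Q_def mult_ac)
    finally show ?thesis .
  qed
qed

end

section \<open>The maximal operator\<close>

context doubling_space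
begin

text \<open>The maximal operator on nonnegative functions, without the conversions between \<open>ereal\<close> and
  \<open>ennreal\<close>.\<close>

definition maximal :: "('a \<Rightarrow> ennreal) \<Rightarrow> 'a \<Rightarrow> ennreal" where
  "maximal u x = (SUP (z, s)\<in>{(z, s). z \<in> space M \<and> 0 < s \<and> x \<in> B z s}.
     (\<integral>\<^sup>+y\<in>B z s. u y \<partial>M) / emeasure M (B z s))"

lemma hl_maximal_eq_maximal:
  "hl_maximal M \<rho> f x = enn2ereal (maximal (\<lambda>y. e2ennreal \<bar>f y\<bar>) x)"
  by (simp add: hl_maximal_def maximal_def)

lemma maximal_divide:
  assumes [measurable]: "u \<in> borel_measurable M"
  shows "maximal (\<lambda>y. u y / c) x = maximal u x / c"
proof -
  have "(\<integral>\<^sup>+y\<in>B z s. u y / c \<partial>M) / emeasure M (B z s)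
      = (\<integral>\<^sup>+y\<in>B z s. u y \<partial>M) / emeasure M (B z s) / c" if "z \<in> space M" "0 < s" for z s
  proof -
    have "(\<integral>\<^sup>+y\<in>B z s. u y / c \<partial>M) = (\<integral>\<^sup>+y. u y * indicator (B z s) y / c \<partial>M)"
      by (intro nn_integral_cong) (auto split: split_indicator)
    also have "\<dots> = (\<integral>\<^sup>+y\<in>B z s. u y \<partial>M) / c"
      using that by (intro nn_integral_divide) auto
    finally show ?thesis by (simp add: divide_ennreal_def mult_ac)
  qed
  then show ?thesis
    unfolding maximal_def SUP_divide_ennreal by (intro SUP_cong) auto
qed

text \<open>With \<open>s \<ge> r\<close>, the balls \<open>B z s\<close> and \<open>B x0 s\<close> meet and have the same radius, so each lies in the
  \<open>\<kappa>\<close>-dilate of the other. Hence \<open>B z s\<close> is contained in a ball about \<open>x0\<close> of at most \<open>D\<^sup>2\<close> times its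
  measure.\<close>

lemma large_ball_average:
  assumes x0: "x0 \<in> space M" and r: "0 < r" and z: "z \<in> space M" and s: "r \<le> s"
    and meet: "B z s \<inter> B x0 r \<noteq> {}" and A: "0 \<le> A"
    and avg: "(\<integral>\<^sup>+y\<in>B x0 (\<kappa> * s). u y \<partial>M) \<le> ennreal A * emeasure M (B x0 (\<kappa> * s))"
  shows "(\<integral>\<^sup>+y\<in>B z s. u y \<partial>M) \<le> ennreal (D\<^sup>2 * A) * emeasure M (B z s)"
proof -
  have s0: "0 < s" using r s by simp
  have meet': "B z s \<inter> B x0 s \<noteq> {}" using meet ball_mono[OF s, of x0] by blast
  have sub1: "B z s \<subseteq> B x0 (\<kappa> * s)" using meet' s0 by (intro ball_engulf z x0) auto
  have sub2: "B x0 s \<subseteq> B z (\<kappa> * s)" using meet' s0 by (intro ball_engulf z x0) auto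
  have ks: "0 < \<kappa> * s" using kappa_pos s0 by simp
  have "(\<integral>\<^sup>+y\<in>B z s. u y \<partial>M) \<le> (\<integral>\<^sup>+y\<in>B x0 (\<kappa> * s). u y \<partial>M)"
    using sub1 by (intro nn_integral_mono) (auto split: split_indicator)
  also note avg
  also have "ennreal A * emeasure M (B x0 (\<kappa> * s)) \<le> ennreal A * (ennreal D * emeasure M (B x0 s))"
    by (intro mult_left_mono emeasure_dilated_ball x0 s0) simp
  also have "\<dots> \<le> ennreal A * (ennreal D * emeasure M (B z (\<kappa> * s)))"
    by (intro mult_left_mono emeasure_mono sub2 ball_sets z ks) simp_all
  also have "\<dots> \<le> ennreal A * (ennreal D * (ennreal D * emeasure M (B z s)))"
    by (intro mult_left_mono emeasure_dilated_ball z s0) simp_all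
  also have "\<dots> = ennreal (D\<^sup>2 * A) * emeasure M (B z s)"
    using A D_ge_1 by (simp add: ennreal_mult power2_eq_square mult_ac)
  finally show ?thesis .
qed

text \<open>Averages over large balls cannot exceed \<open>2 t\<close> by assumption, so every ball responsible for
  \<open>maximal u x > 2 t\<close> has radius below \<open>r\<close> and lies in the \<open>\<kappa>\<close>-dilate of \<open>B x0 r\<close>. On such a ball
  the part of \<open>u\<close> below \<open>t\<close> contributes at most \<open>t\<close> to the average, so the part above \<open>t\<close> still has
  average more than \<open>t\<close>, and \<open>vitali_weak_type\<close> applies to it.\<close>

lemma maximal_level_set:
  assumes u [measurable]: "u \<in> borel_measurable M"
    and x0: "x0 \<in> space M" and r: "0 < r" and t: "0 < t"
    and large: "\<And>z s. z \<in> space M \<Longrightarrow> r \<le> s \<Longrightarrow> B z s \<inter> B x0 r \<noteq> {} \<Longrightarrow>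
      (\<integral>\<^sup>+y\<in>B z s. u y \<partial>M) \<le> ennreal (2 * t) * emeasure M (B z s)"
  shows "\<exists>E\<in>sets M. {x \<in> B x0 r. ennreal (2 * t) < maximal u x} \<subseteq> E \<and>
    ennreal t * emeasure M E
      \<le> ennreal D * (\<integral>\<^sup>+y\<in>B x0 (\<kappa> * r). u y * indicator {ennreal t<..} (u y) \<partial>M)"
proof -
  define g where "g y = u y * indicator {ennreal t<..} (u y)" for y
  have g [measurable]: "g \<in> borel_measurable M" unfolding g_def by measurable
  define I where "I = {(z, s). z \<in> space M \<and> 0 < s \<and> s < r \<and> B z s \<inter> B x0 r \<noteq> {} \<and>
    ennreal (2 * t) * emeasure M (B z s) < (\<integral>\<^sup>+y\<in>B z s. u y \<partial>M)}"
  have kr: "0 < \<kappa> * r" using kappa_pos r by simp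
  have "\<exists>E\<in>sets M. (\<Union>(z, s)\<in>I. B z s) \<subseteq> E \<and>
    ennreal t * emeasure M E \<le> ennreal D * (\<integral>\<^sup>+y\<in>B x0 (\<kappa> * r). g y \<partial>M)"
  proof (rule vitali_weak_type[where R = r])
    fix z s assume zs: "(z, s) \<in> I"
    then show "z \<in> space M \<and> 0 < s \<and> s \<le> r \<and> B z s \<subseteq> B x0 (\<kappa> * r)"
      using ball_engulf[of z x0 s r] x0 r by (auto simp: I_def)
    have z: "z \<in> space M" "0 < s" using zs by (auto simp: I_def)
    have [measurable]: "B z s \<in> sets M" using z by simp
    have fin: "ennreal t * emeasure M (B z s) \<noteq> top"
      using ball_fin[OF z] by (auto simp: ennreal_mult_eq_top_iff)
    have "ennreal t * emeasure M (B z s) + ennreal t * emeasure M (B z s)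
        = ennreal (2 * t) * emeasure M (B z s)"
      using t by (simp add: ennreal_mult mult_2[symmetric] mult.assoc)
    also have "\<dots> \<le> (\<integral>\<^sup>+y\<in>B z s. u y \<partial>M)" using zs by (auto simp: I_def)
    also have "\<dots> \<le> (\<integral>\<^sup>+y. ennreal t * indicator (B z s) y + g y * indicator (B z s) y \<partial>M)"
      by (intro nn_integral_mono) (auto simp: g_def not_less split: split_indicator)
    also have "\<dots> = ennreal t * emeasure M (B z s) + (\<integral>\<^sup>+y\<in>B z s. g y \<partial>M)"
      by (simp add: nn_integral_add nn_integral_cmult)
    finally show "ennreal t * emeasure M (B z s) \<le> (\<integral>\<^sup>+y\<in>B z s. g y \<partial>M)"
      using fin by (simp add: ennreal_add_left_cancel_le)
  qed (use x0 kr ball_fin in auto)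
  moreover have "{x \<in> B x0 r. ennreal (2 * t) < maximal u x} \<subseteq> (\<Union>(z, s)\<in>I. B z s)"
  proof clarify
    fix x assume x: "x \<in> B x0 r" "ennreal (2 * t) < maximal u x"
    then obtain z s where zs: "z \<in> space M" "0 < s" "x \<in> B z s"
      and big: "ennreal (2 * t) < (\<integral>\<^sup>+y\<in>B z s. u y \<partial>M) / emeasure M (B z s)"
      by (auto simp: maximal_def less_SUP_iff)
    have big': "ennreal (2 * t) * emeasure M (B z s) < (\<integral>\<^sup>+y\<in>B z s. u y \<partial>M)"
    proof (rule ccontr)
      assume "\<not> ?thesis"
      then have "(\<integral>\<^sup>+y\<in>B z s. u y \<partial>M) / emeasure M (B z s) \<le> ennreal (2 * t)"
        using ball_pos[OF zs(1,2)] by (intro divide_le_posI_ennreal) (simp_all add: not_less mult.commute[of "emeasure _ _"])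
      then show False using big by simp
    qed
    have "s < r"
    proof (rule ccontr)
      assume "\<not> s < r"
      moreover have "B z s \<inter> B x0 r \<noteq> {}" using x(1) zs(3) by blast
      ultimately show False using large[OF zs(1), of s] big' by (simp add: leD)
    qed
    then have "(z, s) \<in> I" using zs x big' by (auto simp: I_def)
    then show "x \<in> (\<Union>(z, s)\<in>I. B z s)" using zs(3) by blast
  qed
  ultimately obtain E where "E \<in> sets M" "{x \<in> B x0 r. ennreal (2 * t) < maximal u x} \<subseteq> E"
    "ennreal t * emeasure M E \<le> ennreal D * (\<integral>\<^sup>+y\<in>B x0 (\<kappa> * r). g y \<partial>M)"
    by blast
  then show ?thesis unfolding g_def by blast
qed

end

section \<open>The modular estimate on a ball\<close>

locale doubling_orlicz = doubling_space M \<rho> K L + orlicz_power_type \<Phi> p q C1 C2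
  for M :: "'a measure" and \<rho> K L \<Phi> p q C1 C2
begin

lemma average_le_of_ext_average:
  assumes [measurable]: "u \<in> borel_measurable M"
    and x: "x \<in> space M" "0 < s" and a: "0 < a" and w: "0 \<le> w"
    and avg: "(\<integral>\<^sup>+y\<in>B x s. orlicz_ext \<Phi> (u y) \<partial>M) \<le> ennreal w * emeasure M (B x s)"
  shows "(\<integral>\<^sup>+y\<in>B x s. u y \<partial>M) \<le> ennreal (a + C1 * a / \<Phi> a * w) * emeasure M (B x s)"
proof -
  have [measurable]: "B x s \<in> sets M" using x by simp
  have c: "0 \<le> C1 * a / \<Phi> a" using C1_ge_1 a pos[OF a] by simp
  have "(\<integral>\<^sup>+y\<in>B x s. u y \<partial>M)
      \<le> (\<integral>\<^sup>+y. ennreal a * indicator (B x s) y +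
           ennreal (C1 * a / \<Phi> a) * (orlicz_ext \<Phi> (u y) * indicator (B x s) y) \<partial>M)"
    using le_level_plus_ext[OF a] by (intro nn_integral_mono) (auto split: split_indicator)
  also have "\<dots> = ennreal a * emeasure M (B x s) +
      ennreal (C1 * a / \<Phi> a) * (\<integral>\<^sup>+y\<in>B x s. orlicz_ext \<Phi> (u y) \<partial>M)"
    by (simp add: nn_integral_add nn_integral_cmult)
  also have "\<dots> \<le> ennreal a * emeasure M (B x s) +
      ennreal (C1 * a / \<Phi> a) * (ennreal w * emeasure M (B x s))"
    by (intro add_left_mono mult_left_mono avg) simp
  also have "\<dots> = (ennreal a + ennreal (C1 * a / \<Phi> a) * ennreal w) * emeasure M (B x s)"
    by (simp add: distrib_right mult.assoc)
  also have "ennreal a + ennreal (C1 * a / \<Phi> a) * ennreal w = ennreal (a + C1 * a / \<Phi> a * w)"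
    using a c w by (simp only: ennreal_mult[OF c w, symmetric] ennreal_plus[symmetric] less_imp_le mult_nonneg_nonneg)
  finally show ?thesis .
qed

text \<open>\<open>H c * a\<close> bounds the averages of \<open>u\<close> over large balls; in \<open>G c\<close> the first summand accounts for the
  points where the maximal function is at most twice that level, the second for all higher
  levels. Here \<open>c\<close> is the constant in \<open>\<phi>(x, s) \<le> c \<phi>(x, r)\<close> for \<open>r \<le> s\<close>.\<close>

definition H :: "real \<Rightarrow> real" where
  "H c = D\<^sup>2 * (1 + C1 * c * (C2 * 2 powr q))"

definition G :: "real \<Rightarrow> real" where
  "G c = C2 * (2 * H c) powr q + D\<^sup>2 * C3 * c"

lemma H_ge_1: "0 \<le> c \<Longrightarrow> 1 \<le> H c"
proof -
  assume "0 \<le> c"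
  then have "1 * 1 \<le> D\<^sup>2 * (1 + C1 * c * (C2 * 2 powr q))"
    using D_ge_1 C1_ge_1 C2_ge_1 by (intro mult_mono) (auto simp: one_le_power)
  then show ?thesis by (simp add: H_def)
qed

lemma G_pos: "0 < c \<Longrightarrow> 0 < G c"
  using D_ge_1 C2_ge_1 C3_pos by (auto simp: G_def intro!: add_nonneg_pos)

text \<open>The measurable majorant is \<open>\<Phi>(2 A)\<close> plus the sum of \<open>\<Phi>(4 t)\<close> over the levels \<open>t = 2^k A\<close> whose
  covering set contains the point. If \<open>2 t < \<M> u \<le> 4 t\<close> for such a level, one term of the sum suffices;
  if \<open>\<M> u = \<infinity>\<close>, all levels occur and the sum diverges.\<close>

lemma maximal_modular_estimate:
  assumes u [measurable]: "u \<in> borel_measurable M"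
    and x0: "x0 \<in> space M" and r: "0 < r" and v: "0 < v" and c: "0 < c"
    and avg: "\<And>s. r \<le> s \<Longrightarrow>
      (\<integral>\<^sup>+y\<in>B x0 s. orlicz_ext \<Phi> (u y) \<partial>M) \<le> ennreal (c * v) * emeasure M (B x0 s)"
  shows "\<exists>h\<in>borel_measurable M. (\<forall>x\<in>B x0 r. orlicz_ext \<Phi> (maximal u x) \<le> h x) \<and>
    (\<integral>\<^sup>+x\<in>B x0 r. h x \<partial>M) \<le> ennreal (G c * v) * emeasure M (B x0 r)"
proof -
  obtain a where a: "0 < a" "\<Phi> a \<le> v" "v \<le> C2 * 2 powr q * \<Phi> a"
    using level_between_dyadic[OF v] by blast
  define A where "A = H c * a"
  have H: "1 \<le> H c" using H_ge_1 c by simp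
  have A: "0 < A" using H a by (simp add: A_def)
  have [measurable]: "B x0 r \<in> sets M" using x0 r by simp
  have large: "(\<integral>\<^sup>+y\<in>B z s. u y \<partial>M) \<le> ennreal A * emeasure M (B z s)"
    if z: "z \<in> space M" "r \<le> s" "B z s \<inter> B x0 r \<noteq> {}" for z s
  proof -
    have ks: "r \<le> \<kappa> * s" using z r mult_mono[OF kappa_ge_1, of r s] kappa_pos by simp
    have "C1 * a / \<Phi> a * (c * v) \<le> C1 * a / \<Phi> a * (c * (C2 * 2 powr q * \<Phi> a))"
      using a c C1_ge_1 pos[of a] by (intro mult_left_mono) auto
    also have "\<dots> = a * (C1 * c * (C2 * 2 powr q))" using pos[of a] a by simp
    finally have "a + C1 * a / \<Phi> a * (c * v) \<le> a * (1 + C1 * c * (C2 * 2 powr q))"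
      by (simp add: distrib_left)
    then have le: "ennreal (a + C1 * a / \<Phi> a * (c * v)) \<le> ennreal (a * (1 + C1 * c * (C2 * 2 powr q)))"
      by (rule ennreal_leI)
    have "(\<integral>\<^sup>+y\<in>B x0 (\<kappa> * s). u y \<partial>M)
        \<le> ennreal (a + C1 * a / \<Phi> a * (c * v)) * emeasure M (B x0 (\<kappa> * s))"
      using ks r c v by (intro average_le_of_ext_average u x0 a(1) avg) auto
    also have "\<dots> \<le> ennreal (a * (1 + C1 * c * (C2 * 2 powr q))) * emeasure M (B x0 (\<kappa> * s))"
      by (intro mult_right_mono le) simp
    finally have "(\<integral>\<^sup>+y\<in>B z s. u y \<partial>M)
        \<le> ennreal (D\<^sup>2 * (a * (1 + C1 * c * (C2 * 2 powr q)))) * emeasure M (B z s)"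
      using a c C1_ge_1 C2_ge_1 by (intro large_ball_average[OF x0 r z]) auto
    then show ?thesis by (simp add: A_def H_def mult_ac)
  qed
  define t where "t k = 2 ^ k * A" for k :: nat
  have t: "0 < t k" "A \<le> t k" for k
    using A by (simp_all add: t_def)
  define g where "g k y = u y * indicator {ennreal (t k)<..} (u y)" for k y
  have g [measurable]: "g k \<in> borel_measurable M" for k unfolding g_def by measurable
  have level_sets: "\<exists>E\<in>sets M. {x \<in> B x0 r. ennreal (2 * t k) < maximal u x} \<subseteq> E \<and>
    ennreal (t k) * emeasure M E \<le> ennreal D * (\<integral>\<^sup>+y\<in>B x0 (\<kappa> * r). g k y \<partial>M)" for k
    unfolding g_def
  proof (intro maximal_level_set u x0 r t)
    fix z s assume z: "z \<in> space M" "r \<le> s" "B z s \<inter> B x0 r \<noteq> {}"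
    have "A \<le> 2 * t k" using t[of k] by simp
    then have "ennreal A * emeasure M (B z s) \<le> ennreal (2 * t k) * emeasure M (B z s)"
      by (intro mult_right_mono ennreal_leI) simp_all
    then show "(\<integral>\<^sup>+y\<in>B z s. u y \<partial>M) \<le> ennreal (2 * t k) * emeasure M (B z s)"
      using large[OF z] by (rule order_trans[rotated])
  qed
  define E where "E k = (SOME E. E \<in> sets M \<and>
    {x \<in> B x0 r. ennreal (2 * t k) < maximal u x} \<subseteq> E \<and>
    ennreal (t k) * emeasure M E \<le> ennreal D * (\<integral>\<^sup>+y\<in>B x0 (\<kappa> * r). g k y \<partial>M))" for k
  have E_props: "E k \<in> sets M \<and> {x \<in> B x0 r. ennreal (2 * t k) < maximal u x} \<subseteq> E k \<and>
    ennreal (t k) * emeasure M (E k) \<le> ennreal D * (\<integral>\<^sup>+y\<in>B x0 (\<kappa> * r). g k y \<partial>M)" for k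
    unfolding E_def using level_sets[of k, unfolded Bex_def] by (rule someI_ex)
  have E [measurable]: "E k \<in> sets M" for k
    using E_props[of k] by (rule conjunct1)
  have E_cover: "x \<in> E k" if "x \<in> B x0 r" "ennreal (2 * t k) < maximal u x" for k x
    using subsetD[OF E_props[of k, THEN conjunct2, THEN conjunct1], of x] that by simp
  have E_meas: "ennreal (t k) * emeasure M (E k)
      \<le> ennreal D * (\<integral>\<^sup>+y\<in>B x0 (\<kappa> * r). g k y \<partial>M)" for k
    using E_props[of k, THEN conjunct2] by (rule conjunct2)
  define h where "h x = ennreal (\<Phi> (2 * A)) +
    (\<Sum>k. ennreal (\<Phi> (4 * t k)) * indicator (E k) x)" for x
  have h [measurable]: "h \<in> borel_measurable M" unfolding h_def by measurable
  have "orlicz_ext \<Phi> (maximal u x) \<le> h x" if x: "x \<in> B x0 r" for x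
  proof (cases "maximal u x")
    case top
    have "(\<Sum>k. ennreal (\<Phi> (4 * t k)) * indicator (E k) x) = top"
    proof -
      have all: "x \<in> E k" for k using E_cover[OF x, of k] top by simp
      have "(\<Sum>k::nat. ennreal (\<Phi> (4 * A))) \<le> (\<Sum>k. ennreal (\<Phi> (4 * t k)) * indicator (E k) x)"
        using t(2) A all by (intro suminf_le) (auto intro!: ennreal_leI mono')
      moreover have "(\<Sum>k::nat. ennreal (\<Phi> (4 * A))) = top"
      proof (rule ccontr)
        assume fin: "(\<Sum>k::nat. ennreal (\<Phi> (4 * A))) \<noteq> top"
        have P: "0 < \<Phi> (4 * A)" using A by (intro pos) simp
        have "summable (\<lambda>k::nat. \<Phi> (4 * A))"
          by (rule summable_suminf_not_top[OF _ fin]) (use P in simp)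
        then show False using P by (simp only: summable_const_iff)
      qed
      ultimately show ?thesis by (simp add: top_unique)
    qed
    then show ?thesis by (simp add: h_def)
  next
    case (real \<tau>)
    show ?thesis
    proof (cases "\<tau> \<le> 2 * A")
      case True
      then have "orlicz_ext \<Phi> (maximal u x) \<le> ennreal (\<Phi> (2 * A))"
        using real by (simp add: ext_ennreal ennreal_leI mono')
      then show ?thesis by (simp add: h_def add_increasing2)
    next
      case False
      define n where "n = (LEAST n. \<tau> \<le> 4 * t n)"
      have ex: "\<exists>n. \<tau> \<le> 4 * t n"
      proof -
        obtain m :: nat where "\<tau> / A < 2 ^ m" using real_arch_pow[of 2 "\<tau> / A"] by auto
        then have "\<tau> < t m" using A by (simp add: t_def field_simps)
        then show ?thesis using t(1)[of m] by (intro exI[of _ m]) auto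
      qed
      have n: "\<tau> \<le> 4 * t n" unfolding n_def using ex by (rule LeastI_ex)
      have "2 * t n < \<tau>"
      proof (cases n)
        case 0
        then show ?thesis using False by (simp add: t_def)
      next
        case (Suc k)
        then have "\<not> \<tau> \<le> 4 * t k" using not_less_Least[of k "\<lambda>n. \<tau> \<le> 4 * t n"] by (simp add: n_def)
        then show ?thesis by (simp add: Suc t_def)
      qed
      then have "x \<in> E n" using E_cover[OF x, of n] real t(1)[of n] by (simp add: ennreal_less_iff)
      then have "orlicz_ext \<Phi> (maximal u x) \<le> ennreal (\<Phi> (4 * t n)) * indicator (E n) x"
        using real n by (simp add: ext_ennreal ennreal_leI mono')
      also have "\<dots> \<le> (\<Sum>k. ennreal (\<Phi> (4 * t k)) * indicator (E k) x)"
      proof -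
        have "(\<Sum>k\<in>{n}. ennreal (\<Phi> (4 * t k)) * indicator (E k) x)
            \<le> (\<Sum>k. ennreal (\<Phi> (4 * t k)) * indicator (E k) x)"
          by (rule sum_le_suminf) simp_all
        then show ?thesis by (simp only: sum.insert sum.empty finite.emptyI empty_iff not_False_eq_True add_0_right)
      qed
      finally show ?thesis by (simp add: h_def add_increasing)
    qed
  qed
  moreover have "(\<integral>\<^sup>+x\<in>B x0 r. h x \<partial>M) \<le> ennreal (G c * v) * emeasure M (B x0 r)"
  proof -
    have kr: "r \<le> \<kappa> * r" "0 < \<kappa> * r" using r kappa_ge_1 kappa_pos by simp_all
    have [measurable]: "B x0 (\<kappa> * r) \<in> sets M" using x0 kr by simp
    have term_le: "ennreal (\<Phi> (4 * t k)) * emeasure M (E k)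
        \<le> ennreal D * (\<integral>\<^sup>+y\<in>B x0 (\<kappa> * r). ennreal (\<Phi> (4 * t k) / t k) * g k y \<partial>M)" for k
    proof -
      have P: "0 \<le> \<Phi> (4 * t k) / t k" using t(1)[of k] nonneg[of "4 * t k"] by simp
      have "ennreal (\<Phi> (4 * t k)) = ennreal (\<Phi> (4 * t k) / t k) * ennreal (t k)"
        using P t(1)[of k] by (simp add: ennreal_mult[symmetric])
      then have "ennreal (\<Phi> (4 * t k)) * emeasure M (E k)
          = ennreal (\<Phi> (4 * t k) / t k) * (ennreal (t k) * emeasure M (E k))"
        by (simp add: mult.assoc)
      also have "\<dots> \<le> ennreal (\<Phi> (4 * t k) / t k) * (ennreal D * (\<integral>\<^sup>+y\<in>B x0 (\<kappa> * r). g k y \<partial>M))"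
        by (intro mult_left_mono E_meas) simp
      also have "\<dots> = ennreal D * (ennreal (\<Phi> (4 * t k) / t k) * (\<integral>\<^sup>+y\<in>B x0 (\<kappa> * r). g k y \<partial>M))"
        by (simp add: mult_ac)
      also have "ennreal (\<Phi> (4 * t k) / t k) * (\<integral>\<^sup>+y\<in>B x0 (\<kappa> * r). g k y \<partial>M)
          = (\<integral>\<^sup>+y. ennreal (\<Phi> (4 * t k) / t k) * (g k y * indicator (B x0 (\<kappa> * r)) y) \<partial>M)"
        by (rule nn_integral_cmult[symmetric]) measurable
      finally show ?thesis by (simp only: mult.assoc)
    qed
    have h_int: "(\<integral>\<^sup>+x\<in>B x0 r. h x \<partial>M) \<le> ennreal (\<Phi> (2 * A)) * emeasure M (B x0 r) +
        (\<Sum>k. ennreal (\<Phi> (4 * t k)) * emeasure M (E k))"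
    proof -
      have "(\<integral>\<^sup>+x\<in>B x0 r. h x \<partial>M) \<le> (\<integral>\<^sup>+x. ennreal (\<Phi> (2 * A)) * indicator (B x0 r) x +
          (\<Sum>k. ennreal (\<Phi> (4 * t k)) * indicator (E k) x) \<partial>M)"
        by (intro nn_integral_mono) (auto simp: h_def split: split_indicator)
      also have "\<dots> = ennreal (\<Phi> (2 * A)) * emeasure M (B x0 r) +
          (\<Sum>k. ennreal (\<Phi> (4 * t k)) * emeasure M (E k))"
        by (simp add: nn_integral_add nn_integral_cmult nn_integral_suminf)
      finally show ?thesis .
    qed
    have "(\<Sum>k. ennreal (\<Phi> (4 * t k)) * emeasure M (E k))
        \<le> (\<Sum>k. ennreal D * (\<integral>\<^sup>+y\<in>B x0 (\<kappa> * r). ennreal (\<Phi> (4 * t k) / t k) * g k y \<partial>M))"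
      by (intro suminf_le term_le) auto
    also have "\<dots> = ennreal D *
        (\<integral>\<^sup>+y. (\<Sum>k. ennreal (\<Phi> (4 * t k) / t k) * g k y * indicator (B x0 (\<kappa> * r)) y) \<partial>M)"
    proof -
      have "(\<integral>\<^sup>+y. (\<Sum>k. ennreal (\<Phi> (4 * t k) / t k) * g k y * indicator (B x0 (\<kappa> * r)) y) \<partial>M)
          = (\<Sum>k. \<integral>\<^sup>+y\<in>B x0 (\<kappa> * r). ennreal (\<Phi> (4 * t k) / t k) * g k y \<partial>M)"
        by (rule nn_integral_suminf) measurable
      then show ?thesis by (simp only: ennreal_suminf_cmult)
    qed
    also have "\<dots> \<le> ennreal D *
        (\<integral>\<^sup>+y. ennreal C3 * (orlicz_ext \<Phi> (u y) * indicator (B x0 (\<kappa> * r)) y) \<partial>M)"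
      using level_sum_le_ext[OF A]
      by (intro mult_left_mono nn_integral_mono) (auto simp: g_def t_def split: split_indicator)
    also have "\<dots> = ennreal D * (ennreal C3 * (\<integral>\<^sup>+y\<in>B x0 (\<kappa> * r). orlicz_ext \<Phi> (u y) \<partial>M))"
      by (simp add: nn_integral_cmult)
    also have "\<dots> \<le> ennreal D * (ennreal C3 * (ennreal (c * v) * emeasure M (B x0 (\<kappa> * r))))"
      by (intro mult_left_mono avg kr) simp_all
    also have "\<dots> \<le> ennreal D * (ennreal C3 * (ennreal (c * v) * (ennreal D * emeasure M (B x0 r))))"
      by (intro mult_left_mono emeasure_dilated_ball x0 r) simp_all
    also have "\<dots> = ennreal (D\<^sup>2 * C3 * c * v) * emeasure M (B x0 r)"
      using D_ge_1 C3_pos c v by (simp add: ennreal_mult power2_eq_square mult_ac)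
    finally have high: "(\<Sum>k. ennreal (\<Phi> (4 * t k)) * emeasure M (E k))
        \<le> ennreal (D\<^sup>2 * C3 * c * v) * emeasure M (B x0 r)" .
    have low: "ennreal (\<Phi> (2 * A)) \<le> ennreal (C2 * (2 * H c) powr q * v)"
    proof (rule ennreal_leI)
      have "\<Phi> (2 * A) \<le> C2 * (2 * H c) powr q * \<Phi> a"
        using upper[of a "2 * H c"] a H by (simp add: A_def mult.assoc)
      also have "\<dots> \<le> C2 * (2 * H c) powr q * v"
        using a C2_ge_1 by (intro mult_left_mono) auto
      finally show "\<Phi> (2 * A) \<le> C2 * (2 * H c) powr q * v" .
    qed
    have "(\<integral>\<^sup>+x\<in>B x0 r. h x \<partial>M)
        \<le> ennreal (C2 * (2 * H c) powr q * v) * emeasure M (B x0 r) +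
          ennreal (D\<^sup>2 * C3 * c * v) * emeasure M (B x0 r)"
      by (rule order_trans[OF h_int]) (intro add_mono mult_right_mono low high, simp)
    also have "\<dots> = ennreal (G c * v) * emeasure M (B x0 r)"
      using C2_ge_1 D_ge_1 C3_pos c v
      by (simp add: G_def distrib_right ennreal_plus)
    finally show ?thesis .
  qed
  ultimately show ?thesis using h by blast
qed

text \<open>The infimum defining the norm of \<open>f\<close> need not be attained (and may be 0), so the estimate is first
  proved for every positive \<open>l\<close> above it.\<close>

lemma maximal_morrey_bound:
  assumes \<phi>_pos: "\<And>x r. x \<in> space M \<Longrightarrow> 0 < r \<Longrightarrow> 0 < \<phi> x r"
    and c: "0 < c"
    and \<phi>_dec: "\<And>x r s. x \<in> space M \<Longrightarrow> 0 < r \<Longrightarrow> r \<le> s \<Longrightarrow> \<phi> x s \<le> c * \<phi> x r"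
    and f: "f \<in> borel_measurable M"
    and k: "1 < k" "C1 * G c \<le> k"
  shows "orlicz_morrey_norm M \<rho> \<Phi> \<phi> (hl_maximal M \<rho> f)
    \<le> ennreal k * orlicz_morrey_norm M \<rho> \<Phi> \<phi> f"
proof -
  define N where "N = orlicz_morrey_norm M \<rho> \<Phi> \<phi> f"
  have [measurable]: "(\<lambda>y. e2ennreal \<bar>f y\<bar>) \<in> borel_measurable M" using f by measurable
  have step: "orlicz_morrey_norm M \<rho> \<Phi> \<phi> (hl_maximal M \<rho> f) \<le> ennreal (k * l)"
    if l: "0 < l" "N < ennreal l" for l
    unfolding orlicz_morrey_norm_def
  proof (rule SUP_least)
    fix B' assume B': "B' \<in> space M \<times> {0::real<..}"
    define x r where "x = fst B'" and "r = snd B'"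
    have x: "x \<in> space M" and r: "0 < r" and B'_eq: "B' = (x, r)"
      using B' by (auto simp: x_def r_def)
    define u where "u y = e2ennreal \<bar>f y\<bar> / ennreal l" for y
    have u [measurable]: "u \<in> borel_measurable M" unfolding u_def by measurable
    have ball: "(\<integral>\<^sup>+y\<in>B x s. orlicz_ext \<Phi> (u y) \<partial>M) \<le> ennreal (\<phi> x s) * emeasure M (B x s)"
      if s: "0 < s" for s
    proof -
      have "orlicz_morrey_ball_norm M \<rho> \<Phi> \<phi> x s f \<le> N"
        unfolding N_def orlicz_morrey_norm_def using x s by (intro SUP_upper2[of "(x, s)"]) auto
      then have "orlicz_morrey_ball_norm M \<rho> \<Phi> \<phi> x s f < ennreal l" using l by simp
      then obtain l' where l': "0 < l'" "ennreal l' < ennreal l"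
        and le: "upper_nn_integral M (\<lambda>y. orlicz_ext \<Phi> (e2ennreal \<bar>f y\<bar> / ennreal l') *
          indicator (B x s) y) / emeasure M (B x s) \<le> ennreal (\<phi> x s)"
        by (auto simp: orlicz_morrey_ball_norm_def Inf_less_iff)
      have [measurable]: "B x s \<in> sets M" using x s by simp
      have "(\<integral>\<^sup>+y\<in>B x s. orlicz_ext \<Phi> (u y) \<partial>M)
          \<le> (\<integral>\<^sup>+y\<in>B x s. orlicz_ext \<Phi> (e2ennreal \<bar>f y\<bar> / ennreal l') \<partial>M)"
        unfolding u_def using l' l
        by (intro nn_integral_mono mult_right_mono ext_mono)
          (auto simp: divide_ennreal_def inverse_ennreal ennreal_less_iff
            intro!: mult_left_mono ennreal_leI)
      also have "\<dots> = upper_nn_integral M (\<lambda>y. orlicz_ext \<Phi> (e2ennreal \<bar>f y\<bar> / ennreal l') *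
          indicator (B x s) y)"
        by (intro upper_nn_integral_measurable[symmetric]) measurable
      also have "\<dots> = \<dots> / emeasure M (B x s) * emeasure M (B x s)"
        using ball_pos[OF x s] ball_fin[OF x s]
        by (simp add: ennreal_divide_times ennreal_divide_self)
      also have "\<dots> \<le> ennreal (\<phi> x s) * emeasure M (B x s)"
        by (intro mult_right_mono le) simp
      finally show ?thesis .
    qed
    have "\<exists>h\<in>borel_measurable M. (\<forall>y\<in>B x r. orlicz_ext \<Phi> (maximal u y) \<le> h y) \<and>
      (\<integral>\<^sup>+y\<in>B x r. h y \<partial>M) \<le> ennreal (G c * \<phi> x r) * emeasure M (B x r)"
    proof (intro maximal_modular_estimate u x r \<phi>_pos c)
      fix s assume s: "r \<le> s"
      have "(\<integral>\<^sup>+y\<in>B x s. orlicz_ext \<Phi> (u y) \<partial>M) \<le> ennreal (\<phi> x s) * emeasure M (B x s)"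
        using ball r s by simp
      also have "\<dots> \<le> ennreal (c * \<phi> x r) * emeasure M (B x s)"
        by (intro mult_right_mono ennreal_leI \<phi>_dec x r s) simp
      finally show "(\<integral>\<^sup>+y\<in>B x s. orlicz_ext \<Phi> (u y) \<partial>M) \<le> ennreal (c * \<phi> x r) * emeasure M (B x s)" .
    qed
    then obtain h where h [measurable]: "h \<in> borel_measurable M"
      and h_ge: "\<And>y. y \<in> B x r \<Longrightarrow> orlicz_ext \<Phi> (maximal u y) \<le> h y"
      and h_int: "(\<integral>\<^sup>+y\<in>B x r. h y \<partial>M) \<le> ennreal (G c * \<phi> x r) * emeasure M (B x r)"
      by blast
    have G: "0 < G c" using G_pos c .
    have [measurable]: "B x r \<in> sets M" using x r by simp
    have scale: "e2ennreal \<bar>hl_maximal M \<rho> f y\<bar> / ennreal (k * l) = maximal u y / ennreal k" for y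
    proof -
      have "maximal u y = maximal (\<lambda>y. e2ennreal \<bar>f y\<bar>) y / ennreal l"
        unfolding u_def by (rule maximal_divide) measurable
      then show ?thesis
        using k l
        by (simp add: hl_maximal_eq_maximal divide_ennreal_def ennreal_mult ennreal_inverse_mult mult_ac)
    qed
    have "upper_nn_integral M (\<lambda>y. orlicz_ext \<Phi> (e2ennreal \<bar>hl_maximal M \<rho> f y\<bar> / ennreal (k * l)) *
          indicator (B x r) y) \<le> (\<integral>\<^sup>+y. ennreal (1 / G c) * (h y * indicator (B x r) y) \<partial>M)"
      unfolding upper_nn_integral_def scale
    proof (intro INF_lower CollectI conjI ballI)
      fix y
      show "orlicz_ext \<Phi> (maximal u y / ennreal k) * indicator (B x r) y
          \<le> ennreal (1 / G c) * (h y * indicator (B x r) y)"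
        using order_trans[OF ext_divide_le[OF G k, of "maximal u y"]
            mult_left_mono[OF h_ge[of y], of "ennreal (1 / G c)"]]
        by (auto split: split_indicator)
    next
      show "(\<lambda>y. ennreal (1 / G c) * (h y * indicator (B x r) y)) \<in> borel_measurable M" by measurable
    qed
    also have "\<dots> = ennreal (1 / G c) * (\<integral>\<^sup>+y\<in>B x r. h y \<partial>M)" by (simp add: nn_integral_cmult)
    also have "\<dots> \<le> ennreal (1 / G c) * (ennreal (G c * \<phi> x r) * emeasure M (B x r))"
      by (intro mult_left_mono h_int) simp
    also have "\<dots> = ennreal (\<phi> x r) * emeasure M (B x r)"
      using G \<phi>_pos[OF x r] by (simp add: mult.assoc[symmetric] ennreal_mult[symmetric])
    finally have "upper_nn_integral M (\<lambda>y. orlicz_ext \<Phi> (e2ennreal \<bar>hl_maximal M \<rho> f y\<bar> / ennreal (k * l)) *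
          indicator (B x r) y) / emeasure M (B x r) \<le> ennreal (\<phi> x r)"
      using ball_pos[OF x r] by (intro divide_le_posI_ennreal) (simp_all add: mult.commute[of "emeasure _ _"])
    then have "orlicz_morrey_ball_norm M \<rho> \<Phi> \<phi> x r (hl_maximal M \<rho> f) \<le> ennreal (k * l)"
      unfolding orlicz_morrey_ball_norm_def using k l
      by (intro Inf_lower CollectI exI[of _ "k * l"]) auto
    then show "(case B' of (x, r) \<Rightarrow>
        orlicz_morrey_ball_norm M \<rho> \<Phi> \<phi> x r (hl_maximal M \<rho> f)) \<le> ennreal (k * l)"
      by (simp add: B'_eq)
  qed
  show ?thesis
    unfolding N_def[symmetric]
  proof (cases N)
    case top
    then show "orlicz_morrey_norm M \<rho> \<Phi> \<phi> (hl_maximal M \<rho> f) \<le> ennreal k * N"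
      using k by (simp add: ennreal_mult_top)
  next
    case (real n)
    show "orlicz_morrey_norm M \<rho> \<Phi> \<phi> (hl_maximal M \<rho> f) \<le> ennreal k * N"
    proof (rule ennreal_le_epsilon)
      fix e :: real assume e: "0 < e"
      have "0 < n + e / k" "N < ennreal (n + e / k)"
        using real e k by (simp_all add: add_nonneg_pos ennreal_less_iff)
      then have "orlicz_morrey_norm M \<rho> \<Phi> \<phi> (hl_maximal M \<rho> f) \<le> ennreal (k * (n + e / k))"
        by (rule step)
      also have "k * (n + e / k) = k * n + e" using k by (simp add: field_simps)
      also have "ennreal (k * n + e) = ennreal k * N + ennreal e"
        using real e k by (simp add: ennreal_plus ennreal_mult)
      finally show "orlicz_morrey_norm M \<rho> \<Phi> \<phi> (hl_maximal M \<rho> f) \<le> ennreal k * N + ennreal e" .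
    qed
  qed
qed

end

section \<open>Boundedness on the Orlicz--Morrey space\<close>

theorem theorem4p41:
  fixes M :: "'a measure"
    and \<rho> :: "'a \<Rightarrow> 'a \<Rightarrow> real"
    and \<phi> :: "'a \<Rightarrow> real \<Rightarrow> real"
    and \<Phi> :: "real \<Rightarrow> real"
    and r_minus r_plus :: real
  assumes "homogeneous_type M \<rho>"
    and "weak_reverse_doubling M \<rho>"
    and "\<phi> \<in> G1_dec M \<rho>"
    and "nearness (space M) \<rho> \<phi>"
    and "orlicz_function \<Phi>"
    and "strict_mono_on {0..} \<Phi>"
    and "convex_on {0..} \<Phi>"
    and "lower_type \<Phi> r_minus"
    and "upper_type \<Phi> r_plus"
    and "1 < r_minus"
    and "r_minus \<le> r_plus"
  shows "\<exists>C::real. 0 < C \<and>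
    (\<forall>f\<in>orlicz_morrey_space M \<rho> \<Phi> \<phi>.
       orlicz_morrey_norm M \<rho> \<Phi> \<phi> (hl_maximal M \<rho> f)
         \<le> ennreal C * orlicz_morrey_norm M \<rho> \<Phi> \<phi> f)"
proof -
  note homog = assms(1)[unfolded homogeneous_type_def, THEN conjunct2]
  note qm = homog[THEN conjunct1, unfolded quasi_metric_on_def, THEN conjunct2]
  have balls: "\<forall>x\<in>space M. \<forall>r>0. qball (space M) \<rho> x r \<in> sets M"
    and dbl_ex: "\<exists>L\<ge>1. \<forall>x\<in>space M. \<forall>r>0.
        0 < emeasure M (qball (space M) \<rho> x (2 * r)) \<and>
        emeasure M (qball (space M) \<rho> x (2 * r))
          \<le> ennreal L * emeasure M (qball (space M) \<rho> x r) \<and>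
        ennreal L * emeasure M (qball (space M) \<rho> x r) < \<infinity>"
    by (fact homog[THEN conjunct2, THEN conjunct1] homog[THEN conjunct2, THEN conjunct2])+
  have self_iff: "\<forall>x\<in>space M. \<forall>y\<in>space M. \<rho> x y = 0 \<longleftrightarrow> x = y"
    and symm: "\<forall>x\<in>space M. \<forall>y\<in>space M. \<rho> x y = \<rho> y x"
    and K_ex: "\<exists>K\<ge>1. \<forall>x\<in>space M. \<forall>y\<in>space M. \<forall>z\<in>space M. \<rho> x z \<le> K * (\<rho> x y + \<rho> y z)"
    by (fact qm[THEN conjunct1] qm[THEN conjunct2, THEN conjunct1]
        qm[THEN conjunct2, THEN conjunct2])+
  obtain K where K: "1 \<le> K"
    "\<forall>x\<in>space M. \<forall>y\<in>space M. \<forall>z\<in>space M. \<rho> x z \<le> K * (\<rho> x y + \<rho> y z)"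
    using K_ex by (elim exE conjE)
  obtain L where L: "1 \<le> L"
    and dbl: "\<forall>x\<in>space M. \<forall>r>0.
        0 < emeasure M (qball (space M) \<rho> x (2 * r)) \<and>
        emeasure M (qball (space M) \<rho> x (2 * r)) \<le> ennreal L * emeasure M (qball (space M) \<rho> x r) \<and>
        ennreal L * emeasure M (qball (space M) \<rho> x r) < \<infinity>"
    using dbl_ex by (elim exE conjE)
  obtain C1 where C1: "1 \<le> C1"
    "\<And>t s. 0 < t \<Longrightarrow> 0 < s \<Longrightarrow> s < 1 \<Longrightarrow> \<Phi> (s * t) \<le> C1 * s powr r_minus * \<Phi> t"
    using assms(8) unfolding lower_type_def by blast
  obtain C2 where C2: "1 \<le> C2"
    "\<And>t s. 0 < t \<Longrightarrow> 1 < s \<Longrightarrow> \<Phi> (s * t) \<le> C2 * s powr r_plus * \<Phi> t"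
    using assms(9) unfolding upper_type_def by blast
  have \<phi>_pos: "0 < \<phi> x r" if "x \<in> space M" "0 < r" for x r
    using assms(3) that by (simp add: G1_dec_def)
  obtain c0 where c0: "\<phi> x s \<le> c0 * \<phi> x r" if "x \<in> space M" "0 < r" "r < s" for x r s
  proof -
    obtain c0 where "\<forall>x\<in>space M. \<forall>r>0. \<forall>s>r.
        measure M (qball (space M) \<rho> x r) * \<phi> x r
          \<le> c0 * (measure M (qball (space M) \<rho> x s) * \<phi> x s) \<and> \<phi> x s \<le> c0 * \<phi> x r"
      using assms(3) unfolding G1_dec_def mem_Collect_eq by (elim conjE exE)
    then show thesis by (intro that[of c0]) simp
  qed
  interpret doubling_orlicz M \<rho> K L \<Phi> r_minus r_plus C1 C2
  proof unfold_locales
    fix x r assume x: "x \<in> space M" and r: "0 < (r :: real)"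
    show "0 < emeasure M (qball (space M) \<rho> x r)" using bspec[OF dbl x, rule_format, of "r / 2"] r by simp
    show "emeasure M (qball (space M) \<rho> x r) < \<infinity>"
    proof (rule ccontr)
      assume "\<not> emeasure M (qball (space M) \<rho> x r) < \<infinity>"
      then have "emeasure M (qball (space M) \<rho> x r) = top" by (simp add: less_top[symmetric])
      then have "ennreal L * emeasure M (qball (space M) \<rho> x r) = top"
        using L by (simp add: ennreal_mult_top)
      then show False using bspec[OF dbl x, rule_format, OF r] by simp
    qed
    show "emeasure M (qball (space M) \<rho> x (2 * r)) \<le> ennreal L * emeasure M (qball (space M) \<rho> x r)"
      using bspec[OF dbl x, rule_format, OF r] by blast
    show "qball (space M) \<rho> x r \<in> sets M" using balls x r by blast
  next
    show "mono_on {0..} \<Phi>" "\<Phi> 0 = 0" "filterlim \<Phi> at_top at_top"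
      using assms(5) by (simp_all add: orlicz_function_def)
    show "0 < \<Phi> t" if "0 < t" for t using assms(5) that by (simp add: orlicz_function_def)
  next
    fix x y z assume "x \<in> space M" "y \<in> space M" "z \<in> space M"
    then show "\<rho> x z \<le> K * (\<rho> x y + \<rho> y z)" using K by blast
  next
    fix x y assume "x \<in> space M" "y \<in> space M"
    then show "\<rho> x y = \<rho> y x" using symm by blast
  next
    fix x assume "x \<in> space M"
    then show "\<rho> x x = 0" using self_iff by blast
  next
    show "\<Phi> (s * t) \<le> C1 * s powr r_minus * \<Phi> t" if "0 < t" "0 < s" "s < 1" for t s
      using that by (rule C1(2))
    show "\<Phi> (s * t) \<le> C2 * s powr r_plus * \<Phi> t" if "0 < t" "1 < s" for t s
      using that by (rule C2(2))
  qed (rule K(1) L C1(1) C2(1) assms(10))+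
  define c where "c = max 1 c0"
  have c: "0 < c" by (simp add: c_def)
  have \<phi>_dec: "\<phi> x s \<le> c * \<phi> x r" if "x \<in> space M" "0 < r" "r \<le> s" for x r s
  proof (cases "r = s")
    case True
    then show ?thesis using \<phi>_pos[of x r] that by (simp add: c_def)
  next
    case False
    then have "\<phi> x s \<le> c0 * \<phi> x r" using c0 that by simp
    also have "\<dots> \<le> c * \<phi> x r" using \<phi>_pos[of x r] that by (simp add: c_def)
    finally show ?thesis .
  qed
  define k where "k = max 2 (C1 * G c)"
  have "orlicz_morrey_norm M \<rho> \<Phi> \<phi> (hl_maximal M \<rho> f)
      \<le> ennreal k * orlicz_morrey_norm M \<rho> \<Phi> \<phi> f" if "f \<in> orlicz_morrey_space M \<rho> \<Phi> \<phi>" for f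
  proof (rule maximal_morrey_bound[where c = c])
    show "f \<in> borel_measurable M" using that by (simp add: orlicz_morrey_space_def orlicz_loc_def)
    show "1 < k" "C1 * G c \<le> k" by (simp_all add: k_def)
  qed (fact \<phi>_pos \<phi>_dec c)+
  moreover have "0 < k" by (simp add: k_def)
  ultimately show ?thesis by blast
qed

end
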